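(* A graph $G=(V,E)$ has a good 2-detachment if and only if $$e(\mathcal Q)\ge |\mathcal Q|-1+b(\mathcal Q)$$ for all partitions $\mathcal Q$ of $V$. Furthermore, there exists a polynomial time algorithm which returns a good 2-detachment of $G$ when one exists, and otherwise returns a partition $\mathcal Q$ of $V$ violating this inequality.
   Context: Graphs are finite and loopless; parallel edges may occur. For a partition $\mathcal Q$ of $V$, $e(\mathcal Q)$ is the number of edges of $G$ joining different parts of $\mathcal Q$ and $b(\mathcal Q)$ is the number of parts $X\in\mathcal Q$ with $G[X]$ bipartite (a single vertex counts as bipartite). A 2-detachment of $G$ is a graph $H$ with vertex set $V'\cup V''$, where each $v\in V$ is replaced by two new vertices $v'\in V'$ and $v''\in V''$, obtained by adding, for each edge $uv$ of $G$, exactly one of the four edges $u'v',u'v'',u''v',u''v''$. A 2-detachment is good if it is connected and bipartite with bipartition $(V',V'')$. *)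

theory Defs
  imports "HOL-Library.Disjoint_Sets" "HOL-Computational_Algebra.Polynomial"
begin

section \<open>Multigraphs, partitions and 2-detachments\<close>

text \<open>Edges are named objects, so that parallel edges are distinct edges with the same
  set of ends; looplessness is \<open>card (ends G e) = 2\<close>.\<close>

record ('a, 'b) mgraph =
  verts :: "'a set"
  edges :: "'b set"
  ends :: "'b \<Rightarrow> 'a set"

definition multigraph :: "('a, 'b) mgraph \<Rightarrow> bool" where
  "multigraph G \<longleftrightarrow> finite (verts G) \<and> finite (edges G) \<and>
     (\<forall>e\<in>edges G. ends G e \<subseteq> verts G \<and> card (ends G e) = 2)"

definition induced :: "('a, 'b) mgraph \<Rightarrow> 'a set \<Rightarrow> ('a, 'b) mgraph" where
  "induced G X = \<lparr>verts = X, edges = {e \<in> edges G. ends G e \<subseteq> X}, ends = ends G\<rparr>"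

definition bipartition :: "('a, 'b) mgraph \<Rightarrow> 'a set \<Rightarrow> 'a set \<Rightarrow> bool" where
  "bipartition G A B \<longleftrightarrow> verts G = A \<union> B \<and> A \<inter> B = {} \<and>
     (\<forall>e\<in>edges G. \<exists>a\<in>A. \<exists>b\<in>B. ends G e = {a, b})"

definition bipartite :: "('a, 'b) mgraph \<Rightarrow> bool" where
  "bipartite G \<longleftrightarrow> (\<exists>A B. bipartition G A B)"

definition connected_graph :: "('a, 'b) mgraph \<Rightarrow> bool" where
  "connected_graph G \<longleftrightarrow>
     (\<forall>u\<in>verts G. \<forall>v\<in>verts G. (u, v) \<in> {(x, y). \<exists>e\<in>edges G. ends G e = {x, y}}\<^sup>*)"

definition cross_edges :: "('a, 'b) mgraph \<Rightarrow> 'a set set \<Rightarrow> nat" where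
  "cross_edges G Q =
     card {e \<in> edges G. \<exists>X\<in>Q. \<exists>Y\<in>Q. X \<noteq> Y \<and> (\<exists>u\<in>X. \<exists>v\<in>Y. ends G e = {u, v})}"

definition bip_parts :: "('a, 'b) mgraph \<Rightarrow> 'a set set \<Rightarrow> nat" where
  "bip_parts G Q = card {X \<in> Q. bipartite (induced G X)}"

definition partition_condition :: "('a, 'b) mgraph \<Rightarrow> 'a set set \<Rightarrow> bool" where
  "partition_condition G Q \<longleftrightarrow>
     int (cross_edges G Q) \<ge> int (card Q) - 1 + int (bip_parts G Q)"

text \<open>The copies \<open>v'\<close> and \<open>v''\<close> of a vertex \<open>v\<close> are \<open>(v, False)\<close> and \<open>(v, True)\<close>. The edge of
  the detachment that is added for the edge \<open>e\<close> of \<open>G\<close> is again named \<open>e\<close>.\<close>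

definition two_detachment :: "('a, 'b) mgraph \<Rightarrow> ('a \<times> bool, 'b) mgraph \<Rightarrow> bool" where
  "two_detachment G H \<longleftrightarrow> verts H = verts G \<times> UNIV \<and> edges H = edges G \<and>
     (\<forall>e\<in>edges G. \<exists>u v i j. ends G e = {u, v} \<and> ends H e = {(u, i), (v, j)})"

definition good_two_detachment :: "('a, 'b) mgraph \<Rightarrow> ('a \<times> bool, 'b) mgraph \<Rightarrow> bool" where
  "good_two_detachment G H \<longleftrightarrow> two_detachment G H \<and> connected_graph H \<and>
     bipartition H (verts G \<times> {False}) (verts G \<times> {True})"


section \<open>The model of computation\<close>

text \<open>Algorithms are programs of the language WHILE of Jones (\<^emph>\<open>Computability and Complexity from
  a Programming Perspective\<close>): imperative programs over binary trees, in which every elementary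
  operation on trees (constructing a node, taking a subtree, testing for the leaf) costs one
  unit of time. With this cost measure WHILE is polynomially equivalent to Turing machines.\<close>

datatype tree = Leaf | Node tree tree

primrec left :: "tree \<Rightarrow> tree" where
  "left Leaf = Leaf"
| "left (Node s t) = s"

primrec right :: "tree \<Rightarrow> tree" where
  "right Leaf = Leaf"
| "right (Node s t) = t"

type_synonym store = "nat \<Rightarrow> tree"

datatype expr = Var nat | LeafE | NodeE expr expr | LeftE expr | RightE expr

primrec eval_expr :: "expr \<Rightarrow> store \<Rightarrow> tree" where
  "eval_expr (Var x) s = s x"
| "eval_expr LeafE s = Leaf"
| "eval_expr (NodeE a b) s = Node (eval_expr a s) (eval_expr b s)"
| "eval_expr (LeftE a) s = left (eval_expr a s)"
| "eval_expr (RightE a) s = right (eval_expr a s)"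

primrec expr_time :: "expr \<Rightarrow> nat" where
  "expr_time (Var x) = 1"
| "expr_time LeafE = 1"
| "expr_time (NodeE a b) = 1 + expr_time a + expr_time b"
| "expr_time (LeftE a) = 1 + expr_time a"
| "expr_time (RightE a) = 1 + expr_time a"

datatype com = Assign nat expr | Seq com com | If expr com com | While expr com

text \<open>\<open>exec c s t s'\<close>: started in the store \<open>s\<close>, the program \<open>c\<close> terminates after \<open>t\<close> units of
  time in the store \<open>s'\<close>. The leaf is the truth value false.\<close>

inductive exec :: "com \<Rightarrow> store \<Rightarrow> nat \<Rightarrow> store \<Rightarrow> bool" where
  Assign: "exec (Assign x a) s (1 + expr_time a) (s(x := eval_expr a s))"
| Seq: "exec c1 s1 t1 s2 \<Longrightarrow> exec c2 s2 t2 s3 \<Longrightarrow> exec (Seq c1 c2) s1 (t1 + t2) s3"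
| IfTrue: "eval_expr a s \<noteq> Leaf \<Longrightarrow> exec c1 s t s' \<Longrightarrow>
    exec (If a c1 c2) s (1 + expr_time a + t) s'"
| IfFalse: "eval_expr a s = Leaf \<Longrightarrow> exec c2 s t s' \<Longrightarrow>
    exec (If a c1 c2) s (1 + expr_time a + t) s'"
| WhileFalse: "eval_expr a s = Leaf \<Longrightarrow> exec (While a c) s (1 + expr_time a) s"
| WhileTrue: "eval_expr a s1 \<noteq> Leaf \<Longrightarrow> exec c s1 t1 s2 \<Longrightarrow> exec (While a c) s2 t2 s3 \<Longrightarrow>
    exec (While a c) s1 (1 + expr_time a + t1 + t2) s3"

lemma exec_deterministic:
  "exec c s t s' \<Longrightarrow> exec c s u s'' \<Longrightarrow> u = t \<and> s'' = s'"
proof (induction arbitrary: u s'' rule: exec.induct)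
  case (Assign x a s)
  then show ?case by (auto elim: exec.cases)
next
  case (Seq c1 s1 t1 s2 c2 t2 s3)
  from Seq.prems show ?case by cases (use Seq.IH in blast)
next
  case (IfTrue a s c1 t s' c2)
  from IfTrue.prems show ?case by cases (use IfTrue in blast)+
next
  case (IfFalse a s c2 t s' c1)
  from IfFalse.prems show ?case by cases (use IfFalse in blast)+
next
  case (WhileFalse a s c)
  from WhileFalse.prems show ?case by cases (use WhileFalse in auto)
next
  case (WhileTrue a s1 c t1 s2 t2 s3)
  from WhileTrue.prems show ?case by cases (use WhileTrue in blast)+
qed

text \<open>The input is passed in variable 0, which also holds the output at the end.\<close>

definition computes :: "com \<Rightarrow> tree \<Rightarrow> nat \<Rightarrow> tree \<Rightarrow> bool" where
  "computes c x t y \<longleftrightarrow> (\<exists>s. exec c ((\<lambda>_. Leaf)(0 := x)) t s \<and> s 0 = y)"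


section \<open>Inputs and outputs of the algorithm\<close>

text \<open>An input is a number \<open>n\<close> of vertices with a list of edges. The vertices of the graph
  that it represents are \<open>0, \<dots>, n - 1\<close>, and its edges are the positions in the list.\<close>

definition valid_input :: "nat \<Rightarrow> (nat \<times> nat) list \<Rightarrow> bool" where
  "valid_input n es \<longleftrightarrow> (\<forall>(u, v)\<in>set es. u < n \<and> v < n \<and> u \<noteq> v)"

definition list_ends :: "('a \<times> 'a) list \<Rightarrow> nat \<Rightarrow> 'a set" where
  "list_ends es i = {fst (es ! i), snd (es ! i)}"

definition input_graph :: "nat \<Rightarrow> (nat \<times> nat) list \<Rightarrow> (nat, nat) mgraph" where
  "input_graph n es = \<lparr>verts = {..<n}, edges = {..<length es}, ends = list_ends es\<rparr>"

text \<open>A detachment is returned as the list of its edges, in the order of the input edges;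
  a partition is returned as a list of lists.\<close>

datatype answer = Detachment "((nat \<times> bool) \<times> (nat \<times> bool)) list" | Partition "nat list list"

definition output_graph ::
    "nat \<Rightarrow> ((nat \<times> bool) \<times> (nat \<times> bool)) list \<Rightarrow> (nat \<times> bool, nat) mgraph" where
  "output_graph n hs =
     \<lparr>verts = {..<n} \<times> UNIV, edges = {..<length hs}, ends = list_ends hs\<rparr>"

definition output_partition :: "nat list list \<Rightarrow> nat set set" where
  "output_partition xss = set ` set xss"

definition correct_output :: "nat \<Rightarrow> (nat \<times> nat) list \<Rightarrow> answer \<Rightarrow> bool" where
  "correct_output n es out \<longleftrightarrow>
     (if \<exists>H. good_two_detachment (input_graph n es) H
      then \<exists>hs. out = Detachment hs \<and> good_two_detachment (input_graph n es) (output_graph n hs)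
      else \<exists>xss. out = Partition xss \<and>
             partition_on (verts (input_graph n es)) (output_partition xss) \<and>
             \<not> partition_condition (input_graph n es) (output_partition xss))"

text \<open>Numbers are encoded in unary. Since the vertices are \<open>0, \<dots>, n - 1\<close>, the size of the encoding
  of an input is polynomial in the numbers of vertices and edges of the graph.\<close>

primrec enc_nat :: "nat \<Rightarrow> tree" where
  "enc_nat 0 = Leaf"
| "enc_nat (Suc n) = Node Leaf (enc_nat n)"

primrec enc_bool :: "bool \<Rightarrow> tree" where
  "enc_bool False = Leaf"
| "enc_bool True = Node Leaf Leaf"

primrec enc_list :: "('x \<Rightarrow> tree) \<Rightarrow> 'x list \<Rightarrow> tree" where
  "enc_list f [] = Leaf"
| "enc_list f (x # xs) = Node (f x) (enc_list f xs)"

definition enc_pair :: "('x \<Rightarrow> tree) \<Rightarrow> ('y \<Rightarrow> tree) \<Rightarrow> 'x \<times> 'y \<Rightarrow> tree" where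
  "enc_pair f g p = Node (f (fst p)) (g (snd p))"

definition enc_input :: "nat \<Rightarrow> (nat \<times> nat) list \<Rightarrow> tree" where
  "enc_input n es = Node (enc_nat n) (enc_list (enc_pair enc_nat enc_nat) es)"

primrec enc_output :: "answer \<Rightarrow> tree" where
  "enc_output (Detachment hs) =
     Node (enc_bool True)
       (enc_list (enc_pair (enc_pair enc_nat enc_bool) (enc_pair enc_nat enc_bool)) hs)"
| "enc_output (Partition xss) = Node (enc_bool False) (enc_list (enc_list enc_nat) xss)"

text \<open>The time bound is a polynomial in the numbers of vertices and edges.\<close>

definition poly_time_detachment_algorithm :: "com \<Rightarrow> bool" where
  "poly_time_detachment_algorithm c \<longleftrightarrow>
     (\<exists>p :: nat poly. \<forall>n es. valid_input n es \<longrightarrow>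
        (\<exists>out t. computes c (enc_input n es) t (enc_output out) \<and>
           t \<le> poly p (n + length es) \<and> correct_output n es out))"

end

theory Submission
  imports Defs
begin

text \<open>A good 2-detachment of \<open>G\<close> is an orientation of \<open>G\<close>, with the edge oriented from \<open>u\<close> to \<open>v\<close>
  becoming \<open>u'v''\<close>, for which the resulting graph \<open>H\<close> on \<open>V' \<union> V''\<close> is connected. For necessity,
  each bipartite part \<open>X\<close> of a partition splits into two classes of copies that the edges inside \<open>X\<close>
  do not join, so that \<open>|Q| + b(Q)\<close> classes have to be connected by \<open>e(Q)\<close> edges.

  For sufficiency we reverse edges of an arbitrary orientation. Put \<open>L\<^sub>0 = {}\<close> and let \<open>L\<^sub>i\<^sub>+\<^sub>1\<close> consist of the
  edges \<open>uv\<close> such that \<open>u'v''\<close> or \<open>v'u''\<close> joins two components of \<open>H - L\<^sub>i\<close>. Let \<open>k\<close> be minimal such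
  that \<open>L\<^sub>k\<close> contains an edge that is not a bridge of \<open>H\<close>, and reverse this edge. If \<open>k = 1\<close>, the number
  of components of \<open>H\<close> drops; otherwise the components stay the same and, by the exchange property of
  cycles, some edge of \<open>L\<^sub>k\<^sub>-\<^sub>1\<close> is no longer a bridge, so that \<open>k\<close> drops. Hence after polynomially many
  reversals all edges of the union \<open>S\<close> of the levels are bridges, and \<open>H - S\<close> has \<open>|S|\<close> more components
  than \<open>H\<close>. If \<open>H\<close> is not connected, the components of \<open>(V, E - S)\<close> violate the inequality, since both
  copies of each edge of \<open>E - S\<close> stay inside components of \<open>H - S\<close>.

  This local search is the algorithm. Its running time is bounded compositionally: a function between
  encoded types is polynomial if some program computes it with a polynomial bound on both the time
  and the size of the result.\<close>

section \<open>Polynomial time functions on encoded types\<close>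

definition pbounded :: "('a \<Rightarrow> tree) \<Rightarrow> ('a \<Rightarrow> nat) \<Rightarrow> bool" where
  "pbounded A g \<longleftrightarrow> (\<exists>k. \<forall>a. g a \<le> (size (A a) + 2) ^ k)"

lemma pbounded_mono: "pbounded A h \<Longrightarrow> (\<And>a. g a \<le> h a) \<Longrightarrow> pbounded A g"
  unfolding pbounded_def by (meson order_trans)

text \<open>The summand 2 in \<open>pbounded\<close> keeps the base at least 2 even for inputs
  encoded by the leaf, so that constants, and the factor 2 arising from a sum, disappear into the
  exponent.\<close>

lemma pbounded_const: "pbounded A (\<lambda>a. c)"
  unfolding pbounded_def
proof (intro exI[of _ c] allI)
  fix a
  have "c \<le> 2 ^ c" using less_exp[of c] by simp
  also have "\<dots> \<le> (size (A a) + 2) ^ c" by (rule power_mono) auto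
  finally show "c \<le> (size (A a) + 2) ^ c" .
qed

lemma pbounded_size: "pbounded A (\<lambda>a. size (A a))"
  unfolding pbounded_def by (intro exI[of _ 1]) auto

lemma pbounded_add:
  assumes "pbounded A g" "pbounded A h"
  shows "pbounded A (\<lambda>a. g a + h a)"
proof -
  obtain k l where k: "\<And>a. g a \<le> (size (A a) + 2) ^ k" and l: "\<And>a. h a \<le> (size (A a) + 2) ^ l"
    using assms unfolding pbounded_def by blast
  have "g a + h a \<le> (size (A a) + 2) ^ (Suc (k + l))" for a
  proof -
    let ?n = "size (A a) + 2"
    have "?n ^ k \<le> ?n ^ (k + l)" "?n ^ l \<le> ?n ^ (k + l)"
      by (rule power_increasing; simp)+
    then have "g a + h a \<le> 2 * ?n ^ (k + l)" using k[of a] l[of a] by linarith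
    also have "\<dots> \<le> ?n * ?n ^ (k + l)" by (rule mult_right_mono) auto
    finally show ?thesis by simp
  qed
  then show ?thesis unfolding pbounded_def by blast
qed

lemma pbounded_mult:
  assumes "pbounded A g" "pbounded A h"
  shows "pbounded A (\<lambda>a. g a * h a)"
proof -
  obtain k l where k: "\<And>a. g a \<le> (size (A a) + 2) ^ k" and l: "\<And>a. h a \<le> (size (A a) + 2) ^ l"
    using assms unfolding pbounded_def by blast
  have "g a * h a \<le> (size (A a) + 2) ^ (k + l)" for a
    unfolding power_add by (rule mult_mono[OF k l]) auto
  then show ?thesis unfolding pbounded_def by blast
qed

lemma pbounded_power:
  assumes "pbounded A g"
  shows "pbounded A (\<lambda>a. g a ^ k)"
  by (induction k) (auto intro: pbounded_const pbounded_mult assms)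

lemma pbounded_comp:
  assumes "pbounded B g" "pbounded A (\<lambda>a. size (B (f a)))"
  shows "pbounded A (\<lambda>a. g (f a))"
proof -
  obtain k where k: "\<And>b. g b \<le> (size (B b) + 2) ^ k"
    using assms(1) unfolding pbounded_def by blast
  show ?thesis
    by (rule pbounded_mono[OF pbounded_power[OF pbounded_add[OF assms(2) pbounded_const[where c = 2]],
        where k = k] k])
qed

text \<open>The program has to work from any store, with junk in the variables up to \<open>K\<close>; the variables
  above \<open>K\<close> are preserved and can hold values across a call.\<close>

definition realizes ::
    "com \<Rightarrow> nat \<Rightarrow> ('a \<Rightarrow> nat) \<Rightarrow> ('a \<Rightarrow> tree) \<Rightarrow> ('b \<Rightarrow> tree) \<Rightarrow> ('a \<Rightarrow> 'b) \<Rightarrow> bool" where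
  "realizes c K T A B f \<longleftrightarrow>
     (\<forall>a s. s 0 = A a \<longrightarrow>
        (\<exists>t s'. exec c s t s' \<and> s' 0 = B (f a) \<and> (\<forall>i>K. s' i = s i) \<and> t \<le> T a))"

text \<open>The size bound does not follow from the time bound: \<open>NodeE (Var x) (Var x)\<close>
  doubles a tree at constant cost, so a short run can build an exponentially large tree. Composition
  needs it, because the cost of the second program is measured in the size of its own input.\<close>

definition ptime :: "('a \<Rightarrow> tree) \<Rightarrow> ('b \<Rightarrow> tree) \<Rightarrow> ('a \<Rightarrow> 'b) \<Rightarrow> bool" where
  "ptime A B f \<longleftrightarrow> (\<exists>c K T. pbounded A T \<and> realizes c K T A B f) \<and>
     pbounded A (\<lambda>a. size (B (f a)))"

lemma ptime_size: "ptime A B f \<Longrightarrow> pbounded A (\<lambda>a. size (B (f a)))"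
  by (simp add: ptime_def)

text \<open>Enlarging \<open>K\<close> only weakens the preservation clause, so programs with
  different workspaces can be brought to one common bound \<open>L\<close>.\<close>

lemma realizesD:
  assumes "realizes c K T A B f" "K \<le> L" "s 0 = A a"
  shows "\<exists>t s'. exec c s t s' \<and> s' 0 = B (f a) \<and> (\<forall>i>L. s' i = s i) \<and> t \<le> T a"
  using assms unfolding realizes_def by (meson order_le_less_trans)

section \<open>Programs for expressions, composition, pairing, branching and loops\<close>

lemma ptime_expr:
  assumes "\<And>a s. s 0 = A a \<Longrightarrow> eval_expr e s = B (f a)"
    and "pbounded A (\<lambda>a. size (B (f a)))"
  shows "ptime A B f"
proof -
  have "realizes (Assign 0 e) 0 (\<lambda>_. 1 + expr_time e) A B f"
    unfolding realizes_def
  proof (intro allI impI)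
    fix a and s :: store
    assume s: "s 0 = A a"
    show "\<exists>t s'. exec (Assign 0 e) s t s' \<and> s' 0 = B (f a) \<and> (\<forall>i>0. s' i = s i) \<and> t \<le> 1 + expr_time e"
      by (intro exI conjI, rule exec.Assign) (use assms(1)[of s a] s in auto)
  qed
  then show ?thesis using assms(2) pbounded_const unfolding ptime_def by blast
qed

lemma ptime_id: "ptime A A (\<lambda>a. a)"
  by (rule ptime_expr[where e = "Var 0"]) (auto intro: pbounded_size)

lemma ptime_comp:
  assumes "ptime A B f" "ptime B C g"
  shows "ptime A C (\<lambda>a. g (f a))"
proof -
  obtain c K T where c: "pbounded A T" "realizes c K T A B f"
    using assms(1) unfolding ptime_def by blast
  obtain d L U where d: "pbounded B U" "realizes d L U B C g"
    using assms(2) unfolding ptime_def by blast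
  have "realizes (Seq c d) (max K L) (\<lambda>a. T a + U (f a)) A C (\<lambda>a. g (f a))"
    unfolding realizes_def
  proof (intro allI impI)
    fix a and s :: store
    assume s: "s 0 = A a"
    obtain t s' where 1: "exec c s t s'" "s' 0 = B (f a)" "\<And>i. i > max K L \<Longrightarrow> s' i = s i" "t \<le> T a"
      using realizesD[OF c(2), of "max K L" s a] s by auto
    obtain u s'' where 2: "exec d s' u s''" "s'' 0 = C (g (f a))"
      "\<And>i. i > max K L \<Longrightarrow> s'' i = s' i" "u \<le> U (f a)"
      using realizesD[OF d(2), of "max K L" s' "f a"] 1(2) by auto
    show "\<exists>t s'. exec (Seq c d) s t s' \<and> s' 0 = C (g (f a)) \<and>
        (\<forall>i>max K L. s' i = s i) \<and> t \<le> T a + U (f a)"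
      by (intro exI conjI, rule exec.Seq[OF 1(1) 2(1)]) (use 1 2 in auto)
  qed
  moreover have "pbounded A (\<lambda>a. T a + U (f a))"
    by (intro pbounded_add c(1) pbounded_comp[OF d(1)] ptime_size assms(1))
  moreover have "pbounded A (\<lambda>a. size (C (g (f a))))"
    by (rule pbounded_comp[OF ptime_size[OF assms(2)] ptime_size[OF assms(1)]])
  ultimately show ?thesis unfolding ptime_def by blast
qed

lemma size_enc_pair: "size (enc_pair A B p) = Suc (size (A (fst p)) + size (B (snd p)))"
  by (simp add: enc_pair_def)

lemma ptime_Pair:
  assumes "ptime A B f" "ptime A C g"
  shows "ptime A (enc_pair B C) (\<lambda>a. (f a, g a))"
proof -
  obtain c K T where c: "pbounded A T" "realizes c K T A B f"
    using assms(1) unfolding ptime_def by blast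
  obtain d L U where d: "pbounded A U" "realizes d L U A C g"
    using assms(2) unfolding ptime_def by blast
  \<comment> \<open>Above \<open>M\<close> both calls preserve everything: \<open>M+1\<close> keeps
    the input for the second call, and \<open>M+2\<close> keeps the first result during it.\<close>
  define M where "M = max K L"
  have M: "K \<le> M" "L \<le> M" by (auto simp: M_def)
  let ?p = "Seq (Assign (M+1) (Var 0)) (Seq c (Seq (Assign (M+2) (Var 0))
     (Seq (Assign 0 (Var (M+1))) (Seq d (Assign 0 (NodeE (Var (M+2)) (Var 0)))))))"
  have "realizes ?p (M+2) (\<lambda>a. T a + U a + 10) A (enc_pair B C) (\<lambda>a. (f a, g a))"
    unfolding realizes_def
  proof (intro allI impI)
    fix a and s :: store
    assume s: "s 0 = A a"
    let ?s1 = "s(M+1 := A a)"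
    have e1: "exec (Assign (M+1) (Var 0)) s 2 ?s1"
      using exec.Assign[of "M+1" "Var 0" s] s by (simp add: numeral_2_eq_2)
    obtain t s2 where 2: "exec c ?s1 t s2" "s2 0 = B (f a)" "\<And>i. i > M \<Longrightarrow> s2 i = ?s1 i" "t \<le> T a"
      using realizesD[OF c(2), of M ?s1 a] s M by auto
    let ?s3 = "s2(M+2 := B (f a))"
    have e3: "exec (Assign (M+2) (Var 0)) s2 2 ?s3"
      using exec.Assign[of "M+2" "Var 0" s2] 2 by (simp add: numeral_2_eq_2)
    let ?s4 = "?s3(0 := A a)"
    have e4: "exec (Assign 0 (Var (M+1))) ?s3 2 ?s4"
      using exec.Assign[of 0 "Var (M+1)" ?s3] 2(3)[of "M+1"] by (simp add: numeral_2_eq_2)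
    obtain u s5 where 5: "exec d ?s4 u s5" "s5 0 = C (g a)" "\<And>i. i > M \<Longrightarrow> s5 i = ?s4 i" "u \<le> U a"
      using realizesD[OF d(2), of M ?s4 a] M by auto
    let ?s6 = "s5(0 := Node (B (f a)) (C (g a)))"
    have e6: "exec (Assign 0 (NodeE (Var (M+2)) (Var 0))) s5 4 ?s6"
      using exec.Assign[of 0 "NodeE (Var (M+2)) (Var 0)" s5] 5(3)[of "M+2"] 5(2)
      by (simp add: numeral_eq_Suc)
    have "exec ?p s (2 + (t + (2 + (2 + (u + 4))))) ?s6"
      by (intro exec.Seq) (rule e1 2(1) e3 e4 5(1) e6)+
    then show "\<exists>t s'. exec ?p s t s' \<and> s' 0 = enc_pair B C (f a, g a) \<and>
        (\<forall>i>M+2. s' i = s i) \<and> t \<le> T a + U a + 10"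
      by (intro exI conjI) (assumption, use 2 5 in \<open>auto simp: enc_pair_def\<close>)
  qed
  moreover have "pbounded A (\<lambda>a. T a + U a + 10)"
    by (intro pbounded_add c(1) d(1) pbounded_const)
  moreover have "pbounded A (\<lambda>a. size (enc_pair B C (f a, g a)))"
    unfolding size_enc_pair fst_conv snd_conv Suc_eq_plus1
    by (intro pbounded_add pbounded_const ptime_size assms)
  ultimately show ?thesis unfolding ptime_def by blast
qed

lemma ptime_If:
  assumes "ptime A enc_bool P" "ptime A B f" "ptime A B g"
  shows "ptime A B (\<lambda>a. if P a then f a else g a)"
proof -
  obtain b J S where b: "pbounded A S" "realizes b J S A enc_bool P"
    using assms(1) unfolding ptime_def by blast
  obtain c K T where c: "pbounded A T" "realizes c K T A B f"
    using assms(2) unfolding ptime_def by blast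
  obtain d L U where d: "pbounded A U" "realizes d L U A B g"
    using assms(3) unfolding ptime_def by blast
  define M where "M = max J (max K L)"
  have M: "J \<le> M" "K \<le> M" "L \<le> M" by (auto simp: M_def)
  let ?i = "If (Var (M+2)) c d"
  let ?p = "Seq (Assign (M+1) (Var 0)) (Seq b (Seq (Assign (M+2) (Var 0))
     (Seq (Assign 0 (Var (M+1))) ?i)))"
  have "realizes ?p (M+2) (\<lambda>a. S a + T a + U a + 10) A B (\<lambda>a. if P a then f a else g a)"
    unfolding realizes_def
  proof (intro allI impI)
    fix a and s :: store
    assume s: "s 0 = A a"
    let ?s1 = "s(M+1 := A a)"
    have e1: "exec (Assign (M+1) (Var 0)) s 2 ?s1"
      using exec.Assign[of "M+1" "Var 0" s] s by (simp add: numeral_2_eq_2)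
    obtain t s2 where 2: "exec b ?s1 t s2" "s2 0 = enc_bool (P a)" "\<And>i. i > M \<Longrightarrow> s2 i = ?s1 i" "t \<le> S a"
      using realizesD[OF b(2), of M ?s1 a] s M by auto
    let ?s3 = "s2(M+2 := enc_bool (P a))"
    have e3: "exec (Assign (M+2) (Var 0)) s2 2 ?s3"
      using exec.Assign[of "M+2" "Var 0" s2] 2 by (simp add: numeral_2_eq_2)
    let ?s4 = "?s3(0 := A a)"
    have e4: "exec (Assign 0 (Var (M+1))) ?s3 2 ?s4"
      using exec.Assign[of 0 "Var (M+1)" ?s3] 2(3)[of "M+1"] by (simp add: numeral_2_eq_2)
    obtain u s5 where 5: "exec ?i ?s4 (2 + u) s5" "s5 0 = B (if P a then f a else g a)"
        "\<And>i. i > M \<Longrightarrow> s5 i = ?s4 i" "u \<le> T a + U a"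
    proof (cases "P a")
      case True
      obtain u s5 where "exec c ?s4 u s5" "s5 0 = B (f a)" "\<And>i. i > M \<Longrightarrow> s5 i = ?s4 i" "u \<le> T a"
        using realizesD[OF c(2), of M ?s4 a] M by auto
      then show ?thesis
        using exec.IfTrue[of "Var (M+2)" ?s4 c u s5 d] True by (intro that[of u s5]) auto
    next
      case False
      obtain u s5 where "exec d ?s4 u s5" "s5 0 = B (g a)" "\<And>i. i > M \<Longrightarrow> s5 i = ?s4 i" "u \<le> U a"
        using realizesD[OF d(2), of M ?s4 a] M by auto
      then show ?thesis
        using exec.IfFalse[of "Var (M+2)" ?s4 d u s5 c] False by (intro that[of u s5]) auto
    qed
    have "exec ?p s (2 + (t + (2 + (2 + (2 + u))))) s5"
      by (intro exec.Seq) (rule e1 2(1) e3 e4 5(1))+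
    then show "\<exists>t s'. exec ?p s t s' \<and> s' 0 = B (if P a then f a else g a) \<and>
        (\<forall>i>M+2. s' i = s i) \<and> t \<le> S a + T a + U a + 10"
      by (intro exI conjI) (assumption, use 2 5 in auto)
  qed
  moreover have "pbounded A (\<lambda>a. S a + T a + U a + 10)"
    by (intro pbounded_add b(1) c(1) d(1) pbounded_const)
  moreover have "pbounded A (\<lambda>a. size (B (if P a then f a else g a)))"
    by (rule pbounded_mono[OF pbounded_add[OF ptime_size[OF assms(2)] ptime_size[OF assms(3)]]]) auto
  ultimately show ?thesis unfolding ptime_def by blast
qed

lemma length_le_size_enc_list: "length xs \<le> size (enc_list X xs)"
  by (induction xs) auto

lemma size_mem_enc_list: "x \<in> set xs \<Longrightarrow> size (X x) \<le> size (enc_list X xs)"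
  by (induction xs) auto

text \<open>This is the only place where a \<open>While\<close> loop is written; every later
  iteration is an instance. The bound \<open>b\<close> on the states after all prefixes has to be
  supplied, since steps that are polynomial individually may compound to exponential size.\<close>

lemma ptime_foldl:
  assumes h: "ptime A (enc_list X) h" and i: "ptime A S i"
    and f: "ptime (enc_pair A (enc_pair X S)) S (\<lambda>z. f (fst z) (snd (snd z)) (fst (snd z)))"
    and bd: "pbounded A b" "\<And>a k. size (S (foldl (f a) (i a) (take k (h a)))) \<le> b a"
  shows "ptime A S (\<lambda>a. foldl (f a) (i a) (h a))"
proof -
  let ?Z = "enc_pair A (enc_pair X S)"
  obtain ch Kh Th where ch: "pbounded A Th" "realizes ch Kh Th A (enc_list X) h"
    using h unfolding ptime_def by blast
  obtain ci Ki Ti where ci: "pbounded A Ti" "realizes ci Ki Ti A S i"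
    using i unfolding ptime_def by blast
  obtain cf Kf Tf where cf: "pbounded ?Z Tf"
      "realizes cf Kf Tf ?Z S (\<lambda>z. f (fst z) (snd (snd z)) (fst (snd z)))"
    using f unfolding ptime_def by blast
  obtain k where k: "\<And>z. Tf z \<le> (size (?Z z) + 2) ^ k"
    using cf(1) unfolding pbounded_def by blast
  define M where "M = max Kh (max Ki Kf)"
  have M: "Kh \<le> M" "Ki \<le> M" "Kf \<le> M" by (auto simp: M_def)
  \<comment> \<open>Bounds the time of each single step: the two pair nodes of \<open>?Z\<close> and
    the summand 2 of \<open>pbounded\<close> make up the 4.\<close>
  define U where "U a = (size (A a) + size (enc_list X (h a)) + b a + 4) ^ k" for a
  let ?body = "Seq (Assign 0 (NodeE (Var (M+1)) (NodeE (LeftE (Var (M+3))) (Var (M+2)))))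
     (Seq cf (Seq (Assign (M+2) (Var 0)) (Assign (M+3) (RightE (Var (M+3))))))"
  let ?loop = "While (Var (M+3)) ?body"
  \<comment> \<open>\<open>M+1\<close> holds the input, \<open>M+2\<close> the accumulator, and
    \<open>M+3\<close> the part of the list still to be read. The encoding of that part is the leaf
    exactly when it is empty, which makes it the loop test.\<close>
  have loop: "\<exists>t s'. exec ?loop s t s' \<and> s' (M+2) = S (foldl (f a) st xs) \<and>
      (\<forall>i>M+3. s' i = s i) \<and> t \<le> 2 + length xs * (N + 20)"
    if "s (M+1) = A a" "s (M+2) = S st" "s (M+3) = enc_list X xs"
      "\<And>j. j < length xs \<Longrightarrow> Tf (a, xs ! j, foldl (f a) st (take j xs)) \<le> N"
    for s a st xs N
    using that
  proof (induction xs arbitrary: s st)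
    case Nil
    have "exec ?loop s 2 s"
      using exec.WhileFalse[of "Var (M+3)" s ?body] Nil by (simp add: numeral_2_eq_2)
    then show ?case by (intro exI conjI) (assumption, use Nil in auto)
  next
    case (Cons x xs)
    let ?s1 = "s(0 := ?Z (a, x, st))"
    have e1: "exec (Assign 0 (NodeE (Var (M+1)) (NodeE (LeftE (Var (M+3))) (Var (M+2))))) s 7 ?s1"
      using exec.Assign[of 0 "NodeE (Var (M+1)) (NodeE (LeftE (Var (M+3))) (Var (M+2)))" s] Cons.prems
      by (simp add: numeral_eq_Suc enc_pair_def)
    obtain t s2 where 2: "exec cf ?s1 t s2" "s2 0 = S (f a st x)" "\<And>i. i > M \<Longrightarrow> s2 i = ?s1 i"
        "t \<le> Tf (a, x, st)"
      using realizesD[OF cf(2), of M ?s1 "(a, x, st)"] M by auto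
    let ?s3 = "s2(M+2 := S (f a st x))"
    have e3: "exec (Assign (M+2) (Var 0)) s2 2 ?s3"
      using exec.Assign[of "M+2" "Var 0" s2] 2 by (simp add: numeral_2_eq_2)
    let ?s4 = "?s3(M+3 := enc_list X xs)"
    have e4: "exec (Assign (M+3) (RightE (Var (M+3)))) ?s3 3 ?s4"
      using exec.Assign[of "M+3" "RightE (Var (M+3))" ?s3] 2(3)[of "M+3"] Cons.prems
      by (simp add: numeral_eq_Suc)
    have b: "exec ?body s (7 + (t + (2 + 3))) ?s4"
      by (intro exec.Seq) (rule e1 2(1) e3 e4)+
    have "\<exists>t s'. exec ?loop ?s4 t s' \<and> s' (M+2) = S (foldl (f a) (f a st x) xs) \<and>
      (\<forall>i>M+3. s' i = ?s4 i) \<and> t \<le> 2 + length xs * (N + 20)"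
    proof (rule Cons.IH)
      show "Tf (a, xs ! j, foldl (f a) (f a st x) (take j xs)) \<le> N" if "j < length xs" for j
        using Cons.prems(4)[of "Suc j"] that by simp
    qed (use 2(3) Cons.prems in auto)
    then obtain u s5 where 5: "exec ?loop ?s4 u s5" "s5 (M+2) = S (foldl (f a) (f a st x) xs)"
      "\<And>i. i > M+3 \<Longrightarrow> s5 i = ?s4 i" "u \<le> 2 + length xs * (N + 20)" by blast
    have "exec ?loop s (1 + expr_time (Var (M+3)) + (7 + (t + (2 + 3))) + u) s5"
      by (rule exec.WhileTrue[OF _ b 5(1)]) (use Cons.prems in simp)
    moreover have "t \<le> N" using 2(4) Cons.prems(4)[of 0] by simp
    ultimately show ?case by (intro exI conjI) (assumption, use 2 5 in auto)
  qed
  let ?p = "Seq (Assign (M+1) (Var 0)) (Seq ci (Seq (Assign (M+2) (Var 0))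
     (Seq (Assign 0 (Var (M+1))) (Seq ch (Seq (Assign (M+3) (Var 0)) (Seq ?loop
       (Assign 0 (Var (M+2)))))))))"
  let ?T = "\<lambda>a. Ti a + Th a + size (enc_list X (h a)) * (U a + 20) + 20"
  have "realizes ?p (M+3) ?T A S (\<lambda>a. foldl (f a) (i a) (h a))"
    unfolding realizes_def
  proof (intro allI impI)
    fix a and s :: store
    assume s: "s 0 = A a"
    let ?s1 = "s(M+1 := A a)"
    have e1: "exec (Assign (M+1) (Var 0)) s 2 ?s1"
      using exec.Assign[of "M+1" "Var 0" s] s by (simp add: numeral_2_eq_2)
    obtain t s2 where 2: "exec ci ?s1 t s2" "s2 0 = S (i a)" "\<And>i. i > M \<Longrightarrow> s2 i = ?s1 i" "t \<le> Ti a"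
      using realizesD[OF ci(2), of M ?s1 a] s M by auto
    let ?s3 = "s2(M+2 := S (i a))"
    have e3: "exec (Assign (M+2) (Var 0)) s2 2 ?s3"
      using exec.Assign[of "M+2" "Var 0" s2] 2 by (simp add: numeral_2_eq_2)
    let ?s4 = "?s3(0 := A a)"
    have e4: "exec (Assign 0 (Var (M+1))) ?s3 2 ?s4"
      using exec.Assign[of 0 "Var (M+1)" ?s3] 2(3)[of "M+1"] by (simp add: numeral_2_eq_2)
    obtain u s5 where 5: "exec ch ?s4 u s5" "s5 0 = enc_list X (h a)"
      "\<And>i. i > M \<Longrightarrow> s5 i = ?s4 i" "u \<le> Th a"
      using realizesD[OF ch(2), of M ?s4 a] M by auto
    let ?s6 = "s5(M+3 := enc_list X (h a))"
    have e6: "exec (Assign (M+3) (Var 0)) s5 2 ?s6"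
      using exec.Assign[of "M+3" "Var 0" s5] 5 by (simp add: numeral_2_eq_2)
    have "\<exists>t s'. exec ?loop ?s6 t s' \<and> s' (M+2) = S (foldl (f a) (i a) (h a)) \<and>
      (\<forall>i>M+3. s' i = ?s6 i) \<and> t \<le> 2 + length (h a) * (U a + 20)"
    proof (rule loop)
      fix j assume j: "j < length (h a)"
      let ?z = "(a, h a ! j, foldl (f a) (i a) (take j (h a)))"
      have "size (X (h a ! j)) \<le> size (enc_list X (h a))"
        using j by (intro size_mem_enc_list) auto
      then have "size (?Z ?z) + 2 \<le> size (A a) + size (enc_list X (h a)) + b a + 4"
        using bd(2)[of a j] by (simp add: size_enc_pair)
      then show "Tf ?z \<le> U a"
        unfolding U_def by (intro order_trans[OF k] power_mono) auto
    qed (use 2(3) 5(3) in auto)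
    then obtain v s7 where 7: "exec ?loop ?s6 v s7" "s7 (M+2) = S (foldl (f a) (i a) (h a))"
      "\<And>i. i > M+3 \<Longrightarrow> s7 i = ?s6 i" "v \<le> 2 + length (h a) * (U a + 20)" by blast
    let ?s8 = "s7(0 := S (foldl (f a) (i a) (h a)))"
    have e8: "exec (Assign 0 (Var (M+2))) s7 2 ?s8"
      using exec.Assign[of 0 "Var (M+2)" s7] 7(2) by (simp add: numeral_2_eq_2)
    have "exec ?p s (2 + (t + (2 + (2 + (u + (2 + (v + 2))))))) ?s8"
      by (intro exec.Seq) (rule e1 2(1) e3 e4 5(1) e6 7(1) e8)+
    moreover have "2 + (t + (2 + (2 + (u + (2 + (v + 2)))))) \<le> ?T a"
    proof -
      have "length (h a) * (U a + 20) \<le> size (enc_list X (h a)) * (U a + 20)"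
        by (intro mult_right_mono length_le_size_enc_list) auto
      then show ?thesis using 2(4) 5(4) 7(4) by linarith
    qed
    ultimately show "\<exists>t s'. exec ?p s t s' \<and> s' 0 = S (foldl (f a) (i a) (h a)) \<and>
        (\<forall>i>M+3. s' i = s i) \<and> t \<le> ?T a"
      by (intro exI conjI) (assumption, use 2 5 7 in auto)
  qed
  moreover have "pbounded A ?T"
    unfolding U_def
    by (intro pbounded_add pbounded_mult pbounded_power pbounded_const ptime_size[OF h]
        pbounded_size bd(1) ci(1) ch(1))
  moreover have "pbounded A (\<lambda>a. size (S (foldl (f a) (i a) (h a))))"
    by (rule pbounded_mono[OF bd(1)]) (metis bd(2) order_refl take_all)
  ultimately show ?thesis unfolding ptime_def by blast
qed

section \<open>Constants, projections and Boolean connectives\<close>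

primrec tree_expr :: "tree \<Rightarrow> expr" where
  "tree_expr Leaf = LeafE"
| "tree_expr (Node s t) = NodeE (tree_expr s) (tree_expr t)"

lemma eval_tree_expr: "eval_expr (tree_expr t) s = t"
  by (induction t) auto

lemma ptime_const: "ptime A B (\<lambda>a. c)"
  by (rule ptime_expr[where e = "tree_expr (B c)"]) (auto simp: eval_tree_expr intro: pbounded_const)

lemma ptime_fst:
  assumes "ptime A (enc_pair B C) g"
  shows "ptime A B (\<lambda>a. fst (g a))"
proof -
  have "ptime (enc_pair B C) B fst"
    by (rule ptime_expr[where e = "LeftE (Var 0)"])
      (auto simp: enc_pair_def intro: pbounded_mono[OF pbounded_size])
  from ptime_comp[OF assms this] show ?thesis .
qed

lemma ptime_snd:
  assumes "ptime A (enc_pair B C) g"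
  shows "ptime A C (\<lambda>a. snd (g a))"
proof -
  have "ptime (enc_pair B C) C snd"
    by (rule ptime_expr[where e = "RightE (Var 0)"])
      (auto simp: enc_pair_def intro: pbounded_mono[OF pbounded_size])
  from ptime_comp[OF assms this] show ?thesis .
qed

lemma ptime_Not:
  assumes "ptime A enc_bool P"
  shows "ptime A enc_bool (\<lambda>a. \<not> P a)"
proof -
  have "(\<lambda>a. \<not> P a) = (\<lambda>a. if P a then False else True)" by auto
  then show ?thesis by (simp only: ptime_If[OF assms ptime_const ptime_const])
qed

lemma ptime_conj:
  assumes "ptime A enc_bool P" "ptime A enc_bool Q"
  shows "ptime A enc_bool (\<lambda>a. P a \<and> Q a)"
proof -
  have "(\<lambda>a. P a \<and> Q a) = (\<lambda>a. if P a then Q a else False)" by auto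
  then show ?thesis by (simp only: ptime_If[OF assms ptime_const])
qed

lemma ptime_disj:
  assumes "ptime A enc_bool P" "ptime A enc_bool Q"
  shows "ptime A enc_bool (\<lambda>a. P a \<or> Q a)"
proof -
  have "(\<lambda>a. P a \<or> Q a) = (\<lambda>a. if P a then True else Q a)" by auto
  then show ?thesis by (simp only: ptime_If[OF assms(1) ptime_const assms(2)])
qed

section \<open>List operations\<close>

lemma size_enc_list: "size (enc_list X xs) = (\<Sum>x\<leftarrow>xs. Suc (size (X x)))"
  by (induction xs) auto

lemma size_enc_list_le:
  assumes "\<And>x. x \<in> set xs \<Longrightarrow> size (X x) \<le> c"
  shows "size (enc_list X xs) \<le> length xs * Suc c"
  using assms
proof (induction xs)
  case (Cons x xs)
  have "size (X x) \<le> c" "size (enc_list X xs) \<le> length xs * Suc c"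
    using Cons by auto
  then show ?case by simp
qed simp

lemma size_enc_list_append: "size (enc_list X (xs @ ys)) = size (enc_list X xs) + size (enc_list X ys)"
  by (simp add: size_enc_list)

lemma size_enc_list_rev: "size (enc_list X (rev xs)) = size (enc_list X xs)"
  by (simp add: size_enc_list rev_map[symmetric])

lemma size_enc_list_take: "size (enc_list X (take k xs)) \<le> size (enc_list X xs)"
  using size_enc_list_append[of X "take k xs" "drop k xs"] by simp

lemma size_enc_list_drop: "size (enc_list X (drop k xs)) \<le> size (enc_list X xs)"
  using size_enc_list_append[of X "take k xs" "drop k xs"] by simp

lemma size_enc_list_filter: "size (enc_list X (filter P xs)) \<le> size (enc_list X xs)"
  by (induction xs) auto

text \<open>The encoding of a nonempty list is literally that of the pair of its head and tail, so
  the pairing program already computes it.\<close>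

lemma ptime_Cons:
  assumes "ptime A X f" "ptime A (enc_list X) g"
  shows "ptime A (enc_list X) (\<lambda>a. f a # g a)"
proof -
  have "enc_list X (x # xs) = enc_pair X (enc_list X) (x, xs)" for x xs
    by (simp add: enc_pair_def)
  with ptime_Pair[OF assms] show ?thesis by (simp add: ptime_def realizes_def)
qed

text \<open>A fold that accumulates by prepending reverses the list; \<open>ptime_map\<close> and
  \<open>ptime_filter\<close> apply this once more to restore the order.\<close>

lemma ptime_rev:
  assumes "ptime A (enc_list X) h"
  shows "ptime A (enc_list X) (\<lambda>a. rev (h a))"
proof -
  have fl: "foldl (\<lambda>s x. x # s) [] xs = rev xs" for xs :: "'b list"
    by (induction xs rule: rev_induct) auto
  have "ptime A (enc_list X) (\<lambda>a. foldl (\<lambda>s x. x # s) [] (h a))"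
    by (rule ptime_foldl[OF assms ptime_const _ ptime_size[OF assms]])
      ((rule ptime_Cons ptime_fst ptime_snd ptime_id)+, simp add: fl size_enc_list_rev size_enc_list_take)
  then show ?thesis by (simp add: fl)
qed

text \<open>The mapped function may depend on the whole input, so its program reads the input paired
  with the entry. The accumulator is bounded by the number of entries times a bound on all
  images.\<close>

lemma ptime_map:
  assumes h: "ptime A (enc_list X) h" and f: "ptime (enc_pair A X) Y (\<lambda>z. f (fst z) (snd z))"
  shows "ptime A (enc_list Y) (\<lambda>a. map (f a) (h a))"
proof -
  have fl: "foldl (\<lambda>s x. f a x # s) [] xs = rev (map (f a) xs)" for a xs
    by (induction xs rule: rev_induct) auto
  obtain k where k: "\<And>z. size (Y (f (fst z) (snd z))) \<le> (size (enc_pair A X z) + 2) ^ k"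
    using ptime_size[OF f] unfolding pbounded_def by blast
  let ?b = "\<lambda>a. size (enc_list X (h a)) * ((size (A a) + size (enc_list X (h a)) + 3) ^ k + 1)"
  have "ptime A (enc_list Y) (\<lambda>a. foldl (\<lambda>s x. f a x # s) [] (h a))"
  proof (rule ptime_foldl[OF h ptime_const, where b = ?b])
    show "ptime (enc_pair A (enc_pair X (enc_list Y))) (enc_list Y)
       (\<lambda>z. f (fst z) (fst (snd z)) # snd (snd z))"
    proof (rule ptime_Cons)
      have "ptime (enc_pair A (enc_pair X (enc_list Y))) (enc_pair A X) (\<lambda>z. (fst z, fst (snd z)))"
        by (rule ptime_Pair ptime_fst ptime_snd ptime_id)+
      from ptime_comp[OF this f]
      show "ptime (enc_pair A (enc_pair X (enc_list Y))) Y (\<lambda>z. f (fst z) (fst (snd z)))" by simp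
    qed (rule ptime_fst ptime_snd ptime_id)+
    show "pbounded A ?b"
      by (intro pbounded_mult pbounded_add pbounded_power pbounded_const pbounded_size ptime_size[OF h])
    fix a j
    have "size (Y y) \<le> (size (A a) + size (enc_list X (h a)) + 3) ^ k"
      if "y \<in> set (rev (map (f a) (take j (h a))))" for y
    proof -
      from that obtain x where x: "x \<in> set (h a)" "y = f a x" by (auto dest: in_set_takeD)
      have "size (Y y) \<le> (size (enc_pair A X (a, x)) + 2) ^ k"
        using k[of "(a, x)"] x by simp
      also have "\<dots> \<le> (size (A a) + size (enc_list X (h a)) + 3) ^ k"
        using size_mem_enc_list[OF x(1), of X] by (intro power_mono) (auto simp: size_enc_pair)
      finally show ?thesis .
    qed
    then have "size (enc_list Y (rev (map (f a) (take j (h a))))) \<le>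
        length (rev (map (f a) (take j (h a)))) * Suc ((size (A a) + size (enc_list X (h a)) + 3) ^ k)"
      by (rule size_enc_list_le)
    also have "\<dots> \<le> ?b a"
      using length_le_size_enc_list[of "h a" X]
      unfolding Suc_eq_plus1 length_rev length_map length_take by (intro mult_right_mono) auto
    finally show "size (enc_list Y (foldl (\<lambda>s x. f a x # s) [] (take j (h a)))) \<le> ?b a"
      by (simp only: fl)
  qed
  then have "ptime A (enc_list Y) (\<lambda>a. rev (foldl (\<lambda>s x. f a x # s) [] (h a)))"
    by (rule ptime_rev)
  then show ?thesis by (simp add: fl)
qed

lemma ptime_filter:
  assumes h: "ptime A (enc_list X) h" and P: "ptime (enc_pair A X) enc_bool (\<lambda>z. P (fst z) (snd z))"
  shows "ptime A (enc_list X) (\<lambda>a. filter (P a) (h a))"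
proof -
  have fl: "foldl (\<lambda>s x. if P a x then x # s else s) [] xs = rev (filter (P a) xs)" for a xs
    by (induction xs rule: rev_induct) auto
  let ?Z = "enc_pair A (enc_pair X (enc_list X))"
  have "ptime ?Z (enc_pair A X) (\<lambda>z. (fst z, fst (snd z)))"
    by (rule ptime_Pair ptime_fst ptime_snd ptime_id)+
  from ptime_comp[OF this P]
  have P': "ptime ?Z enc_bool (\<lambda>z. P (fst z) (fst (snd z)))" by simp
  have "ptime A (enc_list X) (\<lambda>a. foldl (\<lambda>s x. if P a x then x # s else s) [] (h a))"
  proof (rule ptime_foldl[OF h ptime_const _ ptime_size[OF h]])
    show "ptime ?Z (enc_list X) (\<lambda>z. if P (fst z) (fst (snd z)) then fst (snd z) # snd (snd z) else snd (snd z))"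
      by (rule ptime_If ptime_Cons P' ptime_fst ptime_snd ptime_id)+
    show "size (enc_list X (foldl (\<lambda>s x. if P a x then x # s else s) [] (take k (h a))))
        \<le> size (enc_list X (h a))" for a k
      unfolding fl size_enc_list_rev
      by (rule order_trans[OF size_enc_list_filter size_enc_list_take])
  qed
  then have "ptime A (enc_list X) (\<lambda>a. rev (foldl (\<lambda>s x. if P a x then x # s else s) [] (h a)))"
    by (rule ptime_rev)
  then show ?thesis by (simp add: fl)
qed

lemma ptime_is_Nil:
  assumes "ptime A (enc_list X) h"
  shows "ptime A enc_bool (\<lambda>a. h a = [])"
proof -
  have fl: "foldl (\<lambda>_ _. False) b xs \<longleftrightarrow> b \<and> xs = []" for b and xs :: "'b list"
    by (induction xs arbitrary: b) auto
  have le: "size (enc_bool b) \<le> 1" for b by (cases b) auto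
  have "ptime A enc_bool (\<lambda>a. foldl (\<lambda>_ _. False) True (h a))"
    by (rule ptime_foldl[OF assms ptime_const ptime_const pbounded_const le])
  then show ?thesis by (simp add: fl)
qed

lemma ptime_tl:
  assumes "ptime A (enc_list X) h"
  shows "ptime A (enc_list X) (\<lambda>a. tl (h a))"
proof -
  have "enc_list X (tl xs) = right (enc_list X xs)" for xs
    by (cases xs) auto
  moreover have "size (enc_list X (tl xs)) \<le> size (enc_list X xs)" for xs
    by (cases xs) auto
  ultimately have "ptime (enc_list X) (enc_list X) tl"
    by (intro ptime_expr[where e = "RightE (Var 0)"]) (auto intro: pbounded_mono[OF pbounded_size])
  from ptime_comp[OF assms this] show ?thesis .
qed

definition hd_default :: "'x \<Rightarrow> 'x list \<Rightarrow> 'x" where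
  "hd_default d xs = (case xs of [] \<Rightarrow> d | x # _ \<Rightarrow> x)"

text \<open>Overwriting the state with the current entry leaves the last entry, which is the head of
  the reversed list. Taking the left subtree directly would give the leaf on the empty list, which
  need not encode \<open>d\<close>.\<close>

lemma ptime_hd_default:
  assumes "ptime A (enc_list X) h"
  shows "ptime A X (\<lambda>a. hd_default d (h a))"
proof -
  have fl: "foldl (\<lambda>_ x. x) d xs = hd_default d (rev xs)" for xs
    by (induction xs rule: rev_induct) (auto simp: hd_default_def)
  have "ptime A X (\<lambda>a. foldl (\<lambda>_ x. x) d (rev (h a)))"
  proof (rule ptime_foldl[OF ptime_rev[OF assms] ptime_const])
    show "pbounded A (\<lambda>a. size (enc_list X (h a)) + size (X d))"
      by (intro pbounded_add pbounded_const ptime_size assms)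
    show "size (X (foldl (\<lambda>_ x. x) d (take k (rev (h a))))) \<le> size (enc_list X (h a)) + size (X d)" for a k
    proof -
      have "foldl (\<lambda>_ x. x) d (take k (rev (h a))) \<in> insert d (set (h a))"
        unfolding fl by (auto simp: hd_default_def split: list.split dest!: arg_cong[where f = set] in_set_takeD)
      then show ?thesis using size_mem_enc_list[of _ "h a" X] by fastforce
    qed
  qed (rule ptime_fst ptime_snd ptime_id)+
  then show ?thesis by (simp add: fl)
qed

section \<open>Unary arithmetic\<close>

lemma enc_nat_replicate: "enc_nat n = enc_list (\<lambda>_::unit. Leaf) (replicate n ())"
  by (induction n) auto

lemma size_enc_nat [simp]: "size (enc_nat n) = n"
  by (induction n) auto

lemma foldl_replicate: "foldl (\<lambda>s _. f s) s (replicate n u) = (f ^^ n) s"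
  by (induction n arbitrary: s) (auto simp: funpow_swap1)

text \<open>A unary number is a list of leaves, so a counting loop is a fold that ignores the
  entries.\<close>

lemma ptime_funpow:
  assumes n: "ptime A enc_nat n" and i: "ptime A S i"
    and f: "ptime (enc_pair A S) S (\<lambda>z. f (fst z) (snd z))"
    and bd: "pbounded A b" "\<And>a k. k \<le> n a \<Longrightarrow> size (S ((f a ^^ k) (i a))) \<le> b a"
  shows "ptime A S (\<lambda>a. (f a ^^ n a) (i a))"
proof -
  have n': "ptime A (enc_list (\<lambda>_::unit. Leaf)) (\<lambda>a. replicate (n a) ())"
    using n by (simp add: ptime_def realizes_def enc_nat_replicate)
  have "ptime A S (\<lambda>a. foldl (\<lambda>s _. f a s) (i a) (replicate (n a) ()))"
  proof (rule ptime_foldl[OF n' i _ bd(1)])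
    let ?Z = "enc_pair A (enc_pair (\<lambda>_::unit. Leaf) S)"
    have "ptime ?Z (enc_pair A S) (\<lambda>z. (fst z, snd (snd z)))"
      by (rule ptime_Pair ptime_fst ptime_snd ptime_id)+
    from ptime_comp[OF this f] show "ptime ?Z S (\<lambda>z. f (fst z) (snd (snd z)))" by simp
    show "size (S (foldl (\<lambda>s _. f a s) (i a) (take k (replicate (n a) ())))) \<le> b a" for a k
      using bd(2)[of "min k (n a)" a] by (simp add: foldl_replicate)
  qed
  then show ?thesis by (simp add: foldl_replicate)
qed

lemma ptime_Suc:
  assumes "ptime A enc_nat f"
  shows "ptime A enc_nat (\<lambda>a. Suc (f a))"
proof -
  have "ptime enc_nat enc_nat Suc"
    by (rule ptime_expr[where e = "NodeE LeafE (Var 0)"])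
      (use pbounded_add[OF pbounded_size[of enc_nat] pbounded_const[where c = 1]] in auto)
  from ptime_comp[OF assms this] show ?thesis .
qed

lemma ptime_pred:
  assumes "ptime A enc_nat f"
  shows "ptime A enc_nat (\<lambda>a. f a - 1)"
proof -
  have "enc_nat (n - 1) = right (enc_nat n)" for n
    by (cases n) auto
  moreover have "pbounded enc_nat (\<lambda>n. size (enc_nat (n - 1)))"
    by (rule pbounded_mono[OF pbounded_size]) simp
  ultimately have "ptime enc_nat enc_nat (\<lambda>n. n - 1)"
    by (intro ptime_expr[where e = "RightE (Var 0)"]) auto
  from ptime_comp[OF assms this] show ?thesis .
qed

lemma ptime_plus:
  assumes f: "ptime A enc_nat f" and g: "ptime A enc_nat g"
  shows "ptime A enc_nat (\<lambda>a. f a + g a)"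
proof -
  have fp: "(Suc ^^ k) m = m + k" for k m by (induction k) auto
  have "ptime A enc_nat (\<lambda>a. (Suc ^^ g a) (f a))"
    by (rule ptime_funpow[OF g f _ pbounded_add[OF ptime_size[OF f] ptime_size[OF g]]])
      ((rule ptime_Suc ptime_snd ptime_id)+, simp add: fp)
  then show ?thesis by (simp only: fp)
qed

lemma ptime_minus:
  assumes f: "ptime A enc_nat f" and g: "ptime A enc_nat g"
  shows "ptime A enc_nat (\<lambda>a. f a - g a)"
proof -
  have fp: "((\<lambda>n. n - 1) ^^ k) m = m - k" for k m :: nat by (induction k) auto
  have "ptime A enc_nat (\<lambda>a. ((\<lambda>n. n - 1) ^^ g a) (f a))"
    by (rule ptime_funpow[OF g f _ ptime_size[OF f]])
      ((rule ptime_pred ptime_snd ptime_id)+, simp only: fp size_enc_nat diff_le_self)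
  then show ?thesis by (simp only: fp)
qed

lemma ptime_mult:
  assumes f: "ptime A enc_nat f" and g: "ptime A enc_nat g"
  shows "ptime A enc_nat (\<lambda>a. f a * g a)"
proof -
  have fp: "((\<lambda>n. n + m) ^^ k) 0 = m * k" for k m :: nat by (induction k) auto
  have "ptime A enc_nat (\<lambda>a. ((\<lambda>n. n + f a) ^^ g a) 0)"
    by (rule ptime_funpow[OF g ptime_const _ pbounded_mult[OF ptime_size[OF f] ptime_size[OF g]]])
      ((rule ptime_plus ptime_snd ptime_id ptime_comp[OF ptime_fst[OF ptime_id] f])+, simp add: fp)
  then show ?thesis by (simp only: fp)
qed

lemma ptime_eq_0:
  assumes f: "ptime A enc_nat f"
  shows "ptime A enc_bool (\<lambda>a. f a = 0)"
proof -
  have "ptime A (enc_list (\<lambda>_::unit. Leaf)) (\<lambda>a. replicate (f a) ())"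
    using f by (simp add: ptime_def realizes_def enc_nat_replicate)
  from ptime_is_Nil[OF this] show ?thesis by simp
qed

lemma ptime_eq_nat:
  assumes f: "ptime A enc_nat f" and g: "ptime A enc_nat g"
  shows "ptime A enc_bool (\<lambda>a. f a = g a)"
proof -
  have "ptime A enc_bool (\<lambda>a. f a - g a = 0 \<and> g a - f a = 0)"
    by (intro ptime_conj ptime_eq_0 ptime_minus f g)
  moreover have "(m - n = 0 \<and> n - m = 0) = (m = n)" for m n :: nat by auto
  ultimately show ?thesis by (simp only:)
qed

section \<open>Lengths, ranges and indexing\<close>

lemma ptime_length:
  assumes "ptime A (enc_list X) h"
  shows "ptime A enc_nat (\<lambda>a. length (h a))"
proof -
  have fl: "foldl (\<lambda>n _. Suc n) m xs = m + length xs" for m and xs :: "'b list"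
    by (induction xs arbitrary: m) auto
  have "ptime A enc_nat (\<lambda>a. foldl (\<lambda>n _. Suc n) 0 (h a))"
    by (rule ptime_foldl[OF assms ptime_const _ ptime_size[OF assms]])
      ((rule ptime_Suc ptime_snd ptime_id)+,
        simp add: fl min.coboundedI1 length_le_size_enc_list)
  then show ?thesis by (simp add: fl)
qed

lemma ptime_upt:
  assumes "ptime A enc_nat f"
  shows "ptime A (enc_list enc_nat) (\<lambda>a. [0..<f a])"
proof -
  have fp: "((\<lambda>xs. 0 # map Suc xs) ^^ k) [] = [0..<k]" for k
    by (induction k) (auto simp: map_Suc_upt upt_conv_Cons simp del: upt_Suc)
  have "ptime A (enc_list enc_nat) (\<lambda>a. ((\<lambda>xs. 0 # map Suc xs) ^^ f a) [])"
  proof (rule ptime_funpow[OF assms ptime_const])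
    show "pbounded A (\<lambda>a. f a * (f a + 1))"
      using ptime_size[OF assms] by (intro pbounded_mult pbounded_add pbounded_const) auto
    show "size (enc_list enc_nat (((\<lambda>xs. 0 # map Suc xs) ^^ k) [])) \<le> f a * (f a + 1)"
      if "k \<le> f a" for k a
    proof -
      have "size (enc_list enc_nat [0..<k]) \<le> k * Suc (f a)"
        using that size_enc_list_le[of "[0..<k]" enc_nat "f a"] by auto
      also have "\<dots> \<le> f a * (f a + 1)" using that by (simp add: add_mono)
      finally show ?thesis by (simp only: fp)
    qed
  qed (rule ptime_Cons ptime_map ptime_Suc ptime_const ptime_snd ptime_id)+
  then show ?thesis by (simp only: fp)
qed

lemma ptime_nth_default:
  assumes h: "ptime A (enc_list X) h" and i: "ptime A enc_nat i"
  shows "ptime A X (\<lambda>a. nth_default d (h a) (i a))"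
proof -
  have fp: "(tl ^^ k) xs = drop k xs" for k and xs :: "'b list"
    by (induction k) (auto simp: drop_Suc tl_drop)
  have "ptime A (enc_list X) (\<lambda>a. (tl ^^ i a) (h a))"
    by (rule ptime_funpow[OF i h _ ptime_size[OF h]])
      ((rule ptime_tl ptime_snd ptime_id)+, simp add: fp size_enc_list_drop)
  from ptime_hd_default[OF this, of d]
  have "ptime A X (\<lambda>a. hd_default d (drop (i a) (h a)))" by (simp only: fp)
  moreover have "hd_default d (drop k xs) = nth_default d xs k" for k xs
    by (cases "k < length xs") (auto simp: hd_default_def nth_default_def Cons_nth_drop_Suc[symmetric])
  ultimately show ?thesis by simp
qed

lemma ptime_mem:
  assumes h: "ptime A (enc_list enc_nat) h" and i: "ptime A enc_nat i"
  shows "ptime A enc_bool (\<lambda>a. i a \<in> set (h a))"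
proof -
  have "ptime A enc_bool (\<lambda>a. \<not> filter (\<lambda>j. j = i a) (h a) = [])"
    by (rule ptime_Not ptime_is_Nil ptime_filter[OF h] ptime_eq_nat ptime_snd ptime_id
        ptime_comp[OF ptime_fst[OF ptime_id] i])+
  then show ?thesis by (auto simp: filter_empty_conv)
qed

section \<open>Connectivity as an equivalence closure\<close>

text \<open>Being connected by a walk in the undirected graph with edge set \<open>A\<close>.
  Closing under converses lets each edge be stored as a pair in one fixed direction.\<close>

definition eqcl :: "('v \<times> 'v) set \<Rightarrow> ('v \<times> 'v) set" where
  "eqcl A = (A \<union> A\<inverse>)\<^sup>*"

lemma eqcl_refl [simp]: "(x, x) \<in> eqcl A"
  by (simp add: eqcl_def)

lemma eqcl_sym: "(x, y) \<in> eqcl A \<Longrightarrow> (y, x) \<in> eqcl A"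
  unfolding eqcl_def by (rule symD[OF sym_rtrancl[OF sym_Un_converse]])

lemma eqcl_trans: "(x, y) \<in> eqcl A \<Longrightarrow> (y, z) \<in> eqcl A \<Longrightarrow> (x, z) \<in> eqcl A"
  unfolding eqcl_def by (rule rtrancl_trans)

lemma eqcl_base: "p \<in> A \<Longrightarrow> p \<in> eqcl A"
  unfolding eqcl_def by blast

lemma eqcl_induct [consumes 1, case_names refl step step_sym]:
  assumes "(x, y) \<in> eqcl A" and "P x"
    and "\<And>y z. P y \<Longrightarrow> (y, z) \<in> A \<Longrightarrow> P z" and "\<And>y z. P y \<Longrightarrow> (z, y) \<in> A \<Longrightarrow> P z"
  shows "P y"
  using assms(1) unfolding eqcl_def
proof (induction rule: rtrancl_induct)
  case base
  then show ?case by (rule assms(2))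
next
  case (step y z)
  then consider "(y, z) \<in> A" | "(z, y) \<in> A" by blast
  then show ?case using step.IH assms(3,4) by cases blast+
qed

lemma eqcl_least:
  assumes "A \<subseteq> eqcl B"
  shows "eqcl A \<subseteq> eqcl B"
proof (rule subrelI)
  fix x y assume "(x, y) \<in> eqcl A"
  then show "(x, y) \<in> eqcl B"
  proof (induction rule: eqcl_induct)
    case (step y z)
    then have "(y, z) \<in> eqcl B" using assms by blast
    with step.IH show ?case by (rule eqcl_trans)
  next
    case (step_sym y z)
    then have "(y, z) \<in> eqcl B" using assms by (blast intro: eqcl_sym)
    with step_sym.IH show ?case by (rule eqcl_trans)
  qed simp
qed

lemma eqcl_mono: "A \<subseteq> B \<Longrightarrow> eqcl A \<subseteq> eqcl B"
  by (rule eqcl_least) (blast intro: eqcl_base)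

lemma eqcl_insert_absorb:
  assumes "p \<in> eqcl A"
  shows "eqcl (insert p A) = eqcl A"
proof
  show "eqcl (insert p A) \<subseteq> eqcl A"
    using assms by (intro eqcl_least) (blast intro: eqcl_base)
  show "eqcl A \<subseteq> eqcl (insert p A)" by (rule eqcl_mono) blast
qed

text \<open>A walk can be shortened until it uses the new edge at most once, in one of the two
  directions.\<close>

lemma eqcl_insertD:
  assumes "(x, y) \<in> eqcl (insert (a, b) A)"
  shows "(x, y) \<in> eqcl A \<or> (x, a) \<in> eqcl A \<and> (b, y) \<in> eqcl A \<or> (x, b) \<in> eqcl A \<and> (a, y) \<in> eqcl A"
    (is "?P y")
  using assms
proof (induction rule: eqcl_induct)
  case refl
  then show ?case by simp
next
  case (step y z)
  show ?case
  proof (cases "(y, z) \<in> A")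
    case True
    then have "(y, z) \<in> eqcl A" by (rule eqcl_base)
    then show ?thesis using step.IH eqcl_trans[of _ y A z] by blast
  next
    case False
    then have "y = a" "z = b" using step.hyps by auto
    then show ?thesis using step.IH eqcl_refl[of b A] eqcl_sym[of x y A] by blast
  qed
next
  case (step_sym y z)
  show ?case
  proof (cases "(z, y) \<in> A")
    case True
    then have "(y, z) \<in> eqcl A" by (blast intro: eqcl_base eqcl_sym)
    then show ?thesis using step_sym.IH eqcl_trans[of _ y A z] by blast
  next
    case False
    then have "y = b" "z = a" using step_sym.hyps by auto
    then show ?thesis using step_sym.IH eqcl_refl[of a A] by blast
  qed
qed

text \<open>The exchange property of the graphic matroid: a path between the ends of
  \<open>q\<close> has to use \<open>p\<close>, so \<open>q\<close> closes it to a cycle through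
  \<open>p\<close>.\<close>

lemma eqcl_exchange:
  assumes "q \<in> eqcl (insert p A)" "q \<notin> eqcl A"
  shows "p \<in> eqcl (insert q A)"
proof -
  obtain x y where q: "q = (x, y)" by (rule prod.exhaust)
  obtain a b where p: "p = (a, b)" by (rule prod.exhaust)
  let ?B = "insert q A"
  have m: "r \<in> eqcl ?B" if "r \<in> eqcl A" for r
    using eqcl_mono[of A ?B] that by (rule subsetD) blast
  have xy: "(x, y) \<in> eqcl ?B" "(y, x) \<in> eqcl ?B"
    unfolding q by (rule eqcl_base, simp, rule eqcl_sym, rule eqcl_base, simp)
  from eqcl_insertD[OF assms(1)[unfolded p q]] assms(2)[unfolded q]
  consider "(x, a) \<in> eqcl A" "(b, y) \<in> eqcl A" | "(x, b) \<in> eqcl A" "(a, y) \<in> eqcl A"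
    by blast
  then have "(a, b) \<in> eqcl ?B"
  proof cases
    case 1
    have "(a, x) \<in> eqcl ?B" "(y, b) \<in> eqcl ?B" by (rule eqcl_sym, rule m, fact)+
    then show ?thesis by (meson xy(1) eqcl_trans)
  next
    case 2
    have "(a, y) \<in> eqcl ?B" by (rule m, fact)
    moreover have "(x, b) \<in> eqcl ?B" by (rule m, fact)
    ultimately show ?thesis by (meson xy(2) eqcl_trans)
  qed
  then show ?thesis unfolding p .
qed

text \<open>Add the elements of \<open>B\<close> to \<open>A\<close> one at a time. The element
  whose addition first spans \<open>q\<close> is \<open>p\<close>, and \<open>C\<close> consists of
  \<open>A\<close> and the elements added before it.\<close>

lemma eqcl_exchange_set:
  assumes "finite B" "q \<in> eqcl (A \<union> B)" "q \<notin> eqcl A"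
  obtains p C where "p \<in> B" "A \<subseteq> C" "C \<subseteq> A \<union> (B - {p})" "p \<in> eqcl (insert q C)"
proof -
  have "\<exists>p C. p \<in> B \<and> A \<subseteq> C \<and> C \<subseteq> A \<union> (B - {p}) \<and> p \<in> eqcl (insert q C)"
    using assms(1,2)
  proof (induction B rule: finite_induct)
    case empty
    then show ?case using assms(3) by simp
  next
    case (insert p B)
    show ?case
    proof (cases "q \<in> eqcl (A \<union> B)")
      case True
      then obtain r C
        where "r \<in> B" "A \<subseteq> C" "C \<subseteq> A \<union> (B - {r})" "r \<in> eqcl (insert q C)"
        using insert.IH by (elim meta_impE exE conjE) (simp, rule that)
      then show ?thesis by (intro exI[of _ r] exI[of _ C] conjI) blast+
    next
      case False
      then have "p \<in> eqcl (insert q (A \<union> B))"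
        using insert.prems by (simp add: eqcl_exchange)
      then show ?thesis
        using insert.hyps by (intro exI[of _ p] exI[of _ "A \<union> B"] conjI) blast+
    qed
  qed
  then show ?thesis using that by blast
qed

section \<open>Counting components\<close>

definition comps :: "'v set \<Rightarrow> ('v \<times> 'v) set \<Rightarrow> nat" where
  "comps W R = card ((\<lambda>x. R `` {x}) ` W)"

lemma eqcl_class_eq_iff: "eqcl A `` {x} = eqcl A `` {y} \<longleftrightarrow> (x, y) \<in> eqcl A"
proof
  assume "eqcl A `` {x} = eqcl A `` {y}"
  then have "y \<in> eqcl A `` {x}" by simp
  then show "(x, y) \<in> eqcl A" by simp
next
  assume xy: "(x, y) \<in> eqcl A"
  have "(x, z) \<in> eqcl A \<longleftrightarrow> (y, z) \<in> eqcl A" for z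
    using xy by (metis eqcl_sym eqcl_trans)
  then show "eqcl A `` {x} = eqcl A `` {y}" by auto
qed

text \<open>Taking images under \<open>eqcl B\<close> maps the classes of the finer relation to
  those of the coarser one; all comparisons of component numbers use this map.\<close>

lemma eqcl_class_factor:
  assumes "A \<subseteq> eqcl B"
  shows "eqcl B `` (eqcl A `` {x}) = eqcl B `` {x}"
proof -
  have "(x, y) \<in> eqcl A \<Longrightarrow> (y, z) \<in> eqcl B \<Longrightarrow> (x, z) \<in> eqcl B" for y z
    using eqcl_least[OF assms] by (meson eqcl_trans subsetD)
  then show ?thesis using eqcl_refl[of x A] by blast
qed

text \<open>The classes of \<open>eqcl A\<close> map onto those of \<open>eqcl B\<close>, and the
  class of \<open>y\<close> can be omitted because that of \<open>x\<close> has the same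
  image.\<close>

lemma comps_less:
  assumes W: "finite W" "x \<in> W" "y \<in> W" and A: "A \<subseteq> eqcl B" and xy: "(x, y) \<in> eqcl B" "(x, y) \<notin> eqcl A"
  shows "comps W (eqcl B) < comps W (eqcl A)"
proof -
  let ?f = "\<lambda>x. eqcl A `` {x}" and ?g = "\<lambda>x. eqcl B `` {x}"
  have "?g ` W = (\<lambda>C. eqcl B `` C) ` (?f ` W - {?f y})"
  proof -
    have "?g z \<in> (\<lambda>C. eqcl B `` C) ` (?f ` W - {?f y})" if z: "z \<in> W" for z
    proof (cases "?f z = ?f y")
      case True
      have "?f x \<noteq> ?f y" using xy(2) unfolding eqcl_class_eq_iff .
      moreover have "?g z = ?g x"
        unfolding eqcl_class_eq_iff
        by (rule eqcl_trans[OF subsetD[OF eqcl_least[OF A] True[unfolded eqcl_class_eq_iff]]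
              eqcl_sym[OF xy(1)]])
      then have "?g z = eqcl B `` ?f x" using eqcl_class_factor[OF A] by simp
      ultimately show ?thesis using W(2) by (intro image_eqI[of _ _ "?f x"]) simp_all
    next
      case False
      have "?g z = eqcl B `` ?f z" using eqcl_class_factor[OF A] by simp
      then show ?thesis using False z by (intro image_eqI[of _ _ "?f z"]) simp_all
    qed
    moreover have "eqcl B `` ?f z \<in> ?g ` W" if "z \<in> W" for z
      using that eqcl_class_factor[OF A] by auto
    ultimately show ?thesis by blast
  qed
  then have "card (?g ` W) \<le> card (?f ` W - {?f y})"
    using card_image_le[of "?f ` W - {?f y}" "\<lambda>C. eqcl B `` C"] W(1) by simp
  also have "\<dots> < card (?f ` W)"
    using W by (intro card_Diff1_less) simp_all
  finally show ?thesis by (simp add: comps_def)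
qed

text \<open>Only the classes of \<open>a\<close> and \<open>b\<close> can merge, so the map between
  the classes is injective once the class of \<open>a\<close> is left out.\<close>

lemma comps_insert:
  assumes W: "finite W"
  shows "comps W (eqcl A) \<le> Suc (comps W (eqcl (insert (a, b) A)))"
proof -
  let ?B = "insert (a, b) A"
  let ?f = "\<lambda>x. eqcl A `` {x}" and ?g = "\<lambda>x. eqcl ?B `` {x}"
  have A: "A \<subseteq> eqcl ?B" by (auto intro: eqcl_base)
  have "inj_on (\<lambda>C. eqcl ?B `` C) (?f ` W - {?f a})"
  proof (rule inj_onI)
    fix C D assume C: "C \<in> ?f ` W - {?f a}" and D: "D \<in> ?f ` W - {?f a}"
      and CD: "eqcl ?B `` C = eqcl ?B `` D"
    obtain x y where x: "C = ?f x" "x \<in> W" and y: "D = ?f y" "y \<in> W" using C D by blast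
    have "(x, a) \<notin> eqcl A" "(y, a) \<notin> eqcl A"
      using C D unfolding x y eqcl_class_eq_iff[symmetric] by auto
    moreover have "(x, y) \<in> eqcl ?B"
      using CD unfolding x y eqcl_class_factor[OF A] eqcl_class_eq_iff .
    ultimately have "(x, y) \<in> eqcl A" using eqcl_insertD[of x y a b A] eqcl_sym by metis
    then show "C = D" unfolding x y eqcl_class_eq_iff .
  qed
  moreover have "(\<lambda>C. eqcl ?B `` C) ` (?f ` W - {?f a}) \<subseteq> ?g ` W"
    using eqcl_class_factor[OF A] by auto
  ultimately have "card (?f ` W - {?f a}) \<le> card (?g ` W)"
    using W by (metis card_inj_on_le finite_imageI)
  moreover have "card (?f ` W) \<le> Suc (card (?f ` W - {?f a}))"
    by (auto simp: card_Diff_singleton_if)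
  ultimately show ?thesis unfolding comps_def by linarith
qed

lemma comps_Un:
  assumes "finite W" "finite B"
  shows "comps W (eqcl A) \<le> comps W (eqcl (A \<union> B)) + card B"
  using assms(2)
proof (induction B rule: finite_induct)
  case (insert p B)
  have "comps W (eqcl (A \<union> B)) \<le> Suc (comps W (eqcl (insert p (A \<union> B))))"
    by (metis comps_insert[OF assms(1)] surj_pair)
  then show ?case using insert by simp
qed simp

text \<open>A labelling that is constant along every edge is constant on components, hence factors
  through the set of classes. This gives the lower bound on the number of components in the
  necessity proof.\<close>

lemma card_image_le_comps:
  assumes W: "finite W" and l: "\<And>x y. (x, y) \<in> A \<Longrightarrow> l x = l y"
  shows "card (l ` W) \<le> comps W (eqcl A)"
proof -
  have eq: "l x = l y" if "(x, y) \<in> eqcl A" for x y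
    using that by (induction rule: eqcl_induct) (simp, (metis l)+)
  have "l ` (eqcl A `` {x}) = {l x}" for x
  proof (intro equalityI subsetI)
    fix z assume "z \<in> l ` (eqcl A `` {x})"
    then obtain y where "(x, y) \<in> eqcl A" "z = l y" by blast
    then show "z \<in> {l x}" using eq[of x y] by simp
  qed (use eqcl_refl[of x A] in blast)
  then have "(\<lambda>C. the_elem (l ` C)) ` (\<lambda>x. eqcl A `` {x}) ` W = l ` W"
    unfolding image_image by simp
  then show ?thesis
    using card_image_le[of "(\<lambda>x. eqcl A `` {x}) ` W" "\<lambda>C. the_elem (l ` C)"] W
    by (simp add: comps_def)
qed

text \<open>Using \<open><= 1\<close> instead of equality includes the empty \<open>W\<close>, that
  is, graphs without vertices.\<close>

lemma comps_le_1_iff: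
  assumes "finite W"
  shows "comps W (eqcl A) \<le> 1 \<longleftrightarrow> W \<times> W \<subseteq> eqcl A"
proof -
  let ?C = "(\<lambda>x. eqcl A `` {x}) ` W"
  have "finite ?C" using assms by (rule finite_imageI)
  from card_le_Suc0_iff_eq[OF this]
  have "comps W (eqcl A) \<le> 1 \<longleftrightarrow> (\<forall>C\<in>?C. \<forall>D\<in>?C. C = D)"
    unfolding comps_def One_nat_def .
  also have "\<dots> \<longleftrightarrow> (\<forall>x\<in>W. \<forall>y\<in>W. eqcl A `` {x} = eqcl A `` {y})"
    by (simp only: ball_simps(9))
  also have "\<dots> \<longleftrightarrow> (\<forall>x\<in>W. \<forall>y\<in>W. (x, y) \<in> eqcl A)" by (simp only: eqcl_class_eq_iff)
  also have "\<dots> \<longleftrightarrow> W \<times> W \<subseteq> eqcl A" by blast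
  finally show ?thesis .
qed

section \<open>The local search\<close>

text \<open>A good 2-detachment amounts to an orientation \<open>d\<close> of \<open>G\<close>: the edge \<open>e\<close> with
  \<open>d e = (u, v)\<close> becomes the edge \<open>u'v''\<close>.\<close>

definition arc :: "'a \<times> 'a \<Rightarrow> ('a \<times> bool) \<times> ('a \<times> bool)" where
  "arc p = ((fst p, False), (snd p, True))"

definition reach :: "'b set \<Rightarrow> ('b \<Rightarrow> 'a \<times> 'a) \<Rightarrow> 'b set \<Rightarrow> (('a \<times> bool) \<times> ('a \<times> bool)) set" where
  "reach E d S = eqcl ((\<lambda>e. arc (d e)) ` (E - S))"

text \<open>For an edge outside \<open>S\<close> only the reversed arc can fail the test, since its
  own arc is present in the graph.\<close>

definition crossing :: "'b set \<Rightarrow> ('b \<Rightarrow> 'a \<times> 'a) \<Rightarrow> 'b set \<Rightarrow> 'b set" where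
  "crossing E d S = {e \<in> E. arc (d e) \<notin> reach E d S \<or> arc (prod.swap (d e)) \<notin> reach E d S}"

definition nonbridge :: "'b set \<Rightarrow> ('b \<Rightarrow> 'a \<times> 'a) \<Rightarrow> 'b \<Rightarrow> bool" where
  "nonbridge E d e \<longleftrightarrow> arc (d e) \<in> reach E d {e}"

primrec level :: "'b set \<Rightarrow> ('b \<Rightarrow> 'a \<times> 'a) \<Rightarrow> nat \<Rightarrow> 'b set" where
  "level E d 0 = {}"
| "level E d (Suc i) = crossing E d (level E d i)"

definition flip :: "('b \<Rightarrow> 'a \<times> 'a) \<Rightarrow> 'b \<Rightarrow> 'b \<Rightarrow> 'a \<times> 'a" where
  "flip d e = d(e := prod.swap (d e))"

section \<open>Levels of crossing edges\<close>

lemma reach_antimono: "S \<subseteq> T \<Longrightarrow> reach E d T \<subseteq> reach E d S"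
  unfolding reach_def by (intro eqcl_mono image_mono) auto

lemma arc_in_reach: "e \<in> E \<Longrightarrow> e \<notin> S \<Longrightarrow> arc (d e) \<in> reach E d S"
  unfolding reach_def by (intro eqcl_base) auto

lemma crossing_mono: "S \<subseteq> T \<Longrightarrow> crossing E d S \<subseteq> crossing E d T"
  unfolding crossing_def using reach_antimono[of S T E d] by blast

lemma level_subset: "level E d i \<subseteq> E"
  by (cases i) (auto simp: crossing_def)

lemma level_Suc_mono: "level E d i \<subseteq> level E d (Suc i)"
proof (induction i)
  case (Suc i)
  then show ?case unfolding level.simps by (rule crossing_mono)
qed simp

lemma level_mono: "i \<le> j \<Longrightarrow> level E d i \<subseteq> level E d j"
  using lift_Suc_mono_le[of "level E d", OF level_Suc_mono] .

text \<open>Each level determines the next, so a level can grow only if all earlier ones did; every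
  growth contributes at least one edge.\<close>

lemma card_level:
  assumes "finite E" "level E d (Suc i) \<noteq> level E d i"
  shows "Suc i \<le> card (level E d (Suc i))"
  using assms(2)
proof (induction i)
  case 0
  then have "0 < card (level E d (Suc 0))"
    using finite_subset[OF level_subset assms(1), of d "Suc 0"]
    unfolding card_gt_0_iff level.simps(1) by blast
  then show ?case by (rule Suc_leI)
next
  case (Suc i)
  have "level E d (Suc i) \<noteq> level E d i"
  proof
    assume "level E d (Suc i) = level E d i"
    then have "crossing E d (level E d (Suc i)) = crossing E d (level E d i)" by (rule arg_cong)
    then show False using Suc.prems unfolding level.simps by blast
  qed
  then have "Suc i \<le> card (level E d (Suc i))" by (rule Suc.IH)
  moreover have "card (level E d (Suc i)) < card (level E d (Suc (Suc i)))"
    using Suc.prems level_Suc_mono[of E d "Suc i"]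
    by (intro psubset_card_mono finite_subset[OF level_subset assms(1)]) blast
  ultimately show ?case by linarith
qed

section \<open>Bridges and the effect of one reversal\<close>

lemma reach_remove:
  assumes "e \<in> E" "e \<notin> S"
  shows "reach E d S = eqcl (insert (arc (d e)) ((\<lambda>e. arc (d e)) ` (E - insert e S)))"
proof -
  have "E - S = insert e (E - insert e S)" using assms by auto
  then show ?thesis unfolding reach_def by (metis image_insert)
qed

text \<open>A cycle through \<open>e\<close> contains no bridge. Formally the bridges are deleted
  one by one: if deleting \<open>f\<close> separated the ends of \<open>e\<close>, exchange would
  put \<open>f\<close> on a cycle.\<close>

lemma nonbridge_avoids_bridges:
  assumes "finite B" "B \<subseteq> E" "e \<in> E" "e \<notin> B" "nonbridge E d e" "\<forall>f\<in>B. \<not> nonbridge E d f"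
  shows "arc (d e) \<in> reach E d (insert e B)"
  using assms(1,2,4,6)
proof (induction B rule: finite_induct)
  case empty
  then show ?case using assms(5) by (simp add: nonbridge_def)
next
  case (insert f B)
  let ?A = "(\<lambda>e. arc (d e)) ` (E - insert f (insert e B))"
  have 1: "arc (d e) \<in> eqcl (insert (arc (d f)) ?A)"
    using insert reach_remove[of f E "insert e B" d] by auto
  show ?case
  proof (rule ccontr)
    assume "\<not> ?thesis"
    then have "arc (d e) \<notin> eqcl ?A" by (simp add: reach_def insert_commute)
    from eqcl_exchange[OF 1 this] have "arc (d f) \<in> eqcl (insert (arc (d e)) ?A)" .
    also have "\<dots> \<subseteq> reach E d {f}"
      unfolding reach_def using insert.hyps insert.prems assms(3) by (intro eqcl_mono) auto
    finally have "nonbridge E d f" by (simp add: nonbridge_def)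
    then show False using insert.prems by simp
  qed
qed

lemma reach_flip:
  assumes "e \<in> E" "e \<notin> S"
  shows "reach E (flip d e) S =
    eqcl (insert (arc (prod.swap (d e))) ((\<lambda>e. arc (d e)) ` (E - insert e S)))"
  unfolding reach_remove[OF assms, of "flip d e"] by (auto simp: flip_def intro!: arg_cong[where f = eqcl])

text \<open>The crossing condition is symmetric in the two directions of an edge, so a reversal
  affects it only through \<open>reach\<close>.\<close>

lemma crossing_flip:
  "crossing E (flip d e) S =
    {x \<in> E. arc (d x) \<notin> reach E (flip d e) S \<or> arc (prod.swap (d x)) \<notin> reach E (flip d e) S}"
proof -
  have "arc (flip d e x) \<notin> R \<or> arc (prod.swap (flip d e x)) \<notin> R \<longleftrightarrow>
      arc (d x) \<notin> R \<or> arc (prod.swap (d x)) \<notin> R" for x R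
    by (cases "x = e") (auto simp: flip_def)
  then show ?thesis unfolding crossing_def by simp
qed

lemma reach_without_nonbridge:
  assumes "arc (d e) \<in> reach E d (insert e S)" "e \<in> E" "e \<notin> S"
  shows "eqcl ((\<lambda>e. arc (d e)) ` (E - insert e S)) = reach E d S"
  unfolding reach_remove[OF assms(2,3)]
  by (rule eqcl_insert_absorb[symmetric]) (use assms(1) in \<open>simp add: reach_def\<close>)

text \<open>The index is shifted against the overview: level \<open>k\<close> still consists of
  bridges, and level \<open>Suc k\<close> contains the nonbridge \<open>e\<close> to be reversed.
  For \<open>k = 0\<close> the reversed arc joins two components. For \<open>k > 0\<close> it
  creates a cycle through an edge of level \<open>k\<close>, while the levels up to \<open>k\<close>
  stay the same.\<close>

lemma flip_level:
  assumes fin: "finite E" and B: "\<forall>f\<in>level E d k. \<not> nonbridge E d f"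
    and e: "e \<in> level E d (Suc k)" "nonbridge E d e"
  shows "k = 0 \<Longrightarrow> reach E d {} \<subseteq> reach E (flip d e) {} \<and>
      arc (prod.swap (d e)) \<in> reach E (flip d e) {} - reach E d {}"
    and "k > 0 \<Longrightarrow> reach E d {} = reach E (flip d e) {} \<and> (\<exists>f\<in>level E (flip d e) k. nonbridge E (flip d e) f)"
proof -
  let ?d = "flip d e"
  have eE: "e \<in> E" using e(1) level_subset[of E d "Suc k"] by blast
  have ek: "e \<notin> level E d k" using B e(2) by blast
  have el: "e \<notin> level E d j" if "j \<le> k" for j using ek level_mono[OF that, of E d] by blast
  let ?A = "\<lambda>j. (\<lambda>e. arc (d e)) ` (E - insert e (level E d j))"
  \<comment> \<open>Level \<open>j\<close> consists of bridges, so the cycle through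
    \<open>e\<close> survives its deletion; deleting \<open>e\<close> as well changes no
    component.\<close>
  have A: "eqcl (?A j) = reach E d (level E d j)" if "j \<le> k" for j
    using level_mono[OF that, of E d] B fin level_subset[of E d j]
    by (intro reach_without_nonbridge nonbridge_avoids_bridges eE el e(2) that)
      (auto intro: finite_subset)
  have F: "reach E ?d (level E d j) = eqcl (insert (arc (prod.swap (d e))) (?A j))" if "j \<le> k" for j
    by (rule reach_flip[OF eE el[OF that]])
  have cross: "arc (prod.swap (d e)) \<notin> reach E d (level E d k)"
    using e(1) arc_in_reach[OF eE ek, of d] by (simp add: crossing_def)
  {
    assume "k = 0"
    then show "reach E d {} \<subseteq> reach E ?d {} \<and> arc (prod.swap (d e)) \<in> reach E ?d {} - reach E d {}"
      using F[of 0] A[of 0] cross eqcl_mono[of "?A 0" "insert (arc (prod.swap (d e))) (?A 0)"]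
      by (auto intro: eqcl_base)
  }
  assume k: "k > 0"
  \<comment> \<open>As \<open>e\<close> is not in level \<open>Suc j\<close>, both of its arcs lie
    inside components of the graph without level \<open>j\<close>, where the reversal has no
    effect.\<close>
  have same: "reach E ?d (level E d j) = reach E d (level E d j)" if "j < k" for j
  proof -
    have "e \<notin> level E d (Suc j)" using that by (intro el) auto
    then have "arc (prod.swap (d e)) \<in> eqcl (?A j)"
      using A[of j] that eE by (auto simp: crossing_def)
    then show ?thesis using F[of j] A[of j] that by (simp add: eqcl_insert_absorb)
  qed
  have lev: "level E ?d j = level E d j" if "j \<le> k" for j
    using that
  proof (induction j)
    case (Suc j)
    then have "level E ?d j = level E d j" "reach E ?d (level E d j) = reach E d (level E d j)"
      using same by auto
    then show ?case unfolding level.simps crossing_flip by (simp add: crossing_def)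
  qed simp
  obtain j where j: "k = Suc j" using k gr0_implies_Suc by blast
  have "arc (prod.swap (d e)) \<in> eqcl (?A j)"
    using A[of j] j eE el[of k] by (auto simp: crossing_def)
  moreover have "?A j = ?A k \<union> (\<lambda>e. arc (d e)) ` (level E d k - level E d j)"
    using level_Suc_mono[of E d j] level_subset[of E d k] el[of k] j by auto
  ultimately have 1: "arc (prod.swap (d e)) \<in> eqcl (?A k \<union> (\<lambda>e. arc (d e)) ` (level E d k - level E d j))"
    by metis
  have 2: "arc (prod.swap (d e)) \<notin> eqcl (?A k)" using cross A[of k] by simp
  have "finite ((\<lambda>e. arc (d e)) ` (level E d k - level E d j))"
    using finite_subset[OF level_subset fin, of d k] by simp
  \<comment> \<open>The reversed arc joins different components once level \<open>k\<close> is
    deleted, but not when only level \<open>j\<close> is. Hence it lies on a cycle with an arc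
    \<open>p\<close> of level \<open>k\<close> that is not in level \<open>j\<close>.\<close>
  from eqcl_exchange_set[OF this 1 2] obtain p C where p: "p \<in> (\<lambda>e. arc (d e)) ` (level E d k - level E d j)"
    "C \<subseteq> ?A k \<union> ((\<lambda>e. arc (d e)) ` (level E d k - level E d j) - {p})"
    "p \<in> eqcl (insert (arc (prod.swap (d e))) C)" by metis
  obtain f where f: "f \<in> level E d k" "p = arc (d f)" using p(1) by auto
  have fe: "f \<noteq> e" using f ek by auto
  have "insert (arc (prod.swap (d e))) C \<subseteq> (\<lambda>e. arc (?d e)) ` (E - {f})"
  proof -
    have "arc (prod.swap (d e)) = arc (?d e)" by (simp add: flip_def)
    then have "arc (prod.swap (d e)) \<in> (\<lambda>e. arc (?d e)) ` (E - {f})"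
      using eE fe by (intro image_eqI[of _ _ e]) auto
    moreover have "q \<in> (\<lambda>e. arc (?d e)) ` (E - {f})" if "q \<in> C" for q
    proof -
      have "q \<in> ?A k \<or> q \<in> (\<lambda>e. arc (d e)) ` level E d k \<and> q \<noteq> p" using that p(2) by blast
      \<comment> \<open>The edge \<open>g\<close> behind \<open>q\<close> differs from
        \<open>f\<close>: if it lies outside level \<open>k\<close>, because \<open>f\<close> lies
        inside; otherwise because its arc is not \<open>p\<close>.\<close>
      then obtain g where g: "g \<in> E" "g \<noteq> e" "g \<noteq> f" "q = arc (d g)"
        using f ek level_subset[of E d k] by blast
      then show ?thesis by (intro image_eqI[of _ _ g]) (auto simp: flip_def)
    qed
    ultimately show ?thesis by blast
  qed
  from eqcl_mono[OF this] p(3) have "nonbridge E ?d f"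
    using f(2) fe by (auto simp: nonbridge_def reach_def flip_def)
  then show "reach E d {} = reach E ?d {} \<and> (\<exists>f\<in>level E ?d k. nonbridge E ?d f)"
    using f(1) lev[of k] same[of 0] k by auto
qed

section \<open>Search steps and the decrease of the potential\<close>

definition search_inv :: "'b set \<Rightarrow> ('b \<Rightarrow> 'a \<times> 'a) \<Rightarrow> 'b set \<Rightarrow> bool" where
  "search_inv E d S \<longleftrightarrow> (\<exists>i. S = level E d i) \<and> (\<forall>e\<in>S. \<not> nonbridge E d e)"

text \<open>A relation, so that termination is shown for every choice of the nonbridge to be
  reversed. After a reversal the levels are built again from \<open>{}\<close>, since the later ones
  may have changed.\<close>

definition search_step ::
    "'b set \<Rightarrow> ('b \<Rightarrow> 'a \<times> 'a) \<Rightarrow> 'b set \<Rightarrow> ('b \<Rightarrow> 'a \<times> 'a) \<Rightarrow> 'b set \<Rightarrow> bool" where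
  "search_step E d S d' S' \<longleftrightarrow>
     (\<exists>e\<in>crossing E d S. nonbridge E d e \<and> d' = flip d e \<and> S' = {}) \<or>
     (\<forall>e\<in>crossing E d S. \<not> nonbridge E d e) \<and> d' = d \<and> S' = crossing E d S"

text \<open>The levels increase, so these indices form an initial segment and their number records
  the first level with a nonbridge. The cap \<open>card E\<close> keeps the set finite when all
  levels consist of bridges.\<close>

definition bridge_levels :: "'b set \<Rightarrow> ('b \<Rightarrow> 'a \<times> 'a) \<Rightarrow> nat set" where
  "bridge_levels E d = {i. i \<le> card E \<and> (\<forall>e\<in>level E d i. \<not> nonbridge E d e)}"

text \<open>A lexicographic measure: each factor exceeds the range of the entries after it.\<close>

definition potential :: "'a set \<Rightarrow> 'b set \<Rightarrow> ('b \<Rightarrow> 'a \<times> 'a) \<Rightarrow> 'b set \<Rightarrow> nat" where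
  "potential V E d S = (comps (V \<times> UNIV) (reach E d {}) * (card E + 2) + card (bridge_levels E d)) *
     (card E + 1) + (card E - card S)"

lemma search_step_inv:
  assumes "search_inv E d S" "search_step E d S d' S'"
  shows "search_inv E d' S'"
proof -
  obtain i where "S = level E d i" using assms(1) unfolding search_inv_def by blast
  then have "crossing E d S = level E d (Suc i)" by simp
  then show ?thesis using assms(2) unfolding search_inv_def search_step_def
    by (metis empty_iff level.simps(1))
qed

lemma bridge_levels_subset: "bridge_levels E d \<subseteq> {..card E}"
  by (auto simp: bridge_levels_def)

lemma card_bridge_levels: "card (bridge_levels E d) \<le> card E + 1"
  using card_mono[OF finite_atMost bridge_levels_subset, of E d] by simp

text \<open>Growing \<open>S\<close> lowers only the last entry. A reversal resets \<open>S\<close>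
  and may raise that entry by up to \<open>card E\<close>, which the factor
  \<open>card E + 1\<close> on a decrease of the earlier entries outweighs.\<close>

lemma search_step_potential:
  assumes fin: "finite V" "finite E" and d: "d ` E \<subseteq> V \<times> V"
    and inv: "search_inv E d S" and step: "search_step E d S d' S'"
    and ne: "d' \<noteq> d \<or> S' \<noteq> S"
  shows "potential V E d' S' < potential V E d S"
proof -
  obtain k where k: "S = level E d k" using inv unfolding search_inv_def by blast
  have B: "\<forall>f\<in>level E d k. \<not> nonbridge E d f" using inv k unfolding search_inv_def by blast
  have next_level: "crossing E d S = level E d (Suc k)" using k by simp
  let ?m = "card E" and ?c = "\<lambda>d. comps (V \<times> (UNIV :: bool set)) (reach E d {})"
  let ?b = "\<lambda>d. card (bridge_levels E d)"
  from step consider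
    (flip) e where "e \<in> level E d (Suc k)" "nonbridge E d e" "d' = flip d e" "S' = {}"
  | (grow) "d' = d" "S' = level E d (Suc k)"
    unfolding search_step_def next_level by blast
  then show ?thesis
  proof cases
    case grow
    then have "S \<subset> S'" using ne level_Suc_mono[of E d k] k by auto
    moreover have "S' \<subseteq> E" using grow level_subset[of E d "Suc k"] by simp
    ultimately have "card S < card S'" "card S' \<le> ?m"
      using fin by (meson finite_subset psubset_card_mono, meson card_mono)
    then show ?thesis using grow unfolding potential_def by auto
  next
    case flip
    have fe: "e \<in> E" using flip level_subset[of E d "Suc k"] by blast
    have "level E d (Suc k) \<noteq> level E d k" using B flip by blast
    \<comment> \<open>Level \<open>Suc k\<close> is strictly larger than level \<open>k\<close>, so
      \<open>k\<close> stays below the cap in \<open>bridge_levels\<close>.\<close>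
    then have km: "Suc k \<le> ?m"
      using card_level[OF fin(2), of d k] card_mono[OF fin(2) level_subset[of E d "Suc k"]] by linarith
    have less: "?c d' * (?m + 2) + ?b d' < ?c d * (?m + 2) + ?b d"
    proof (cases "k = 0")
      case True
      note f = flip_level(1)[OF fin(2) B flip(1,2) True]
      obtain u v where uv: "d e = (u, v)" by (metis surj_pair)
      have "u \<in> V" "v \<in> V" using d fe uv by auto
      have "?c d' < ?c d"
        unfolding reach_def
      proof (rule comps_less)
        show "finite (V \<times> (UNIV :: bool set))" "(v, False) \<in> V \<times> UNIV" "(u, True) \<in> V \<times> UNIV"
          using fin \<open>u \<in> V\<close> \<open>v \<in> V\<close> by auto
        show "(\<lambda>e. arc (d e)) ` (E - {}) \<subseteq> eqcl ((\<lambda>e. arc (d' e)) ` (E - {}))"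
        proof
          fix p assume "p \<in> (\<lambda>e. arc (d e)) ` (E - {})"
          then have "p \<in> reach E d {}" unfolding reach_def by (rule eqcl_base)
          then have "p \<in> reach E d' {}" using f unfolding flip(3) by (meson subsetD)
          then show "p \<in> eqcl ((\<lambda>e. arc (d' e)) ` (E - {}))" unfolding reach_def .
        qed
        show "((v, False), (u, True)) \<in> eqcl ((\<lambda>e. arc (d' e)) ` (E - {}))"
          "((v, False), (u, True)) \<notin> eqcl ((\<lambda>e. arc (d e)) ` (E - {}))"
          using f unfolding flip(3) uv reach_def arc_def by simp_all
      qed
      \<comment> \<open>Losing a component is worth \<open>?m + 2\<close>, more than the at most
        \<open>?m + 1\<close> bridge levels that may be gained.\<close>
      then have "Suc (?c d') * (?m + 2) \<le> ?c d * (?m + 2)"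
        by (intro mult_right_mono) auto
      then show ?thesis using card_bridge_levels[of E d'] by simp
    next
      case False
      note f = flip_level(2)[OF fin(2) B flip(1,2)]
      \<comment> \<open>Level \<open>k\<close> of the new orientation has a nonbridge, hence so has
        every later level. Before the reversal all indices from \<open>0\<close> to \<open>k\<close>
        were counted.\<close>
      have "bridge_levels E d' \<subseteq> {..<k}"
      proof
        fix i assume i: "i \<in> bridge_levels E d'"
        show "i \<in> {..<k}"
        proof (rule ccontr)
          assume "i \<notin> {..<k}"
          then have "level E d' k \<subseteq> level E d' i" by (intro level_mono) auto
          then show False using f False i unfolding bridge_levels_def flip(3) by blast
        qed
      qed
      moreover have "{..k} \<subseteq> bridge_levels E d"
        using B km level_mono[of _ k E d] unfolding bridge_levels_def by fastforce
      ultimately have "?b d' \<le> k" "Suc k \<le> ?b d"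
        using card_mono[of "{..<k}" "bridge_levels E d'"]
          card_mono[of "bridge_levels E d" "{..k}"] finite_subset[OF bridge_levels_subset[of E d]]
        by auto
      then show ?thesis using f False flip(3) by auto
    qed
    then have "Suc (?c d' * (?m + 2) + ?b d') * (?m + 1) \<le> (?c d * (?m + 2) + ?b d) * (?m + 1)"
      by (intro mult_right_mono) auto
    then show ?thesis unfolding potential_def by simp
  qed
qed

section \<open>Orientations and termination of the search\<close>

definition orients :: "('b \<Rightarrow> 'a \<times> 'a) \<Rightarrow> ('a, 'b) mgraph \<Rightarrow> bool" where
  "orients d G \<longleftrightarrow> (\<forall>e\<in>edges G. ends G e = {fst (d e), snd (d e)})"

lemma orients_flip:
  assumes "orients d G"
  shows "orients (flip d e) G"
  unfolding orients_def
proof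
  fix x assume "x \<in> edges G"
  then have "ends G x = {fst (d x), snd (d x)}" using assms unfolding orients_def by (rule bspec[rotated])
  then show "ends G x = {fst (flip d e x), snd (flip d e x)}"
    by (cases "x = e") (simp_all add: flip_def insert_commute)
qed

lemma search_step_orients: "orients d G \<Longrightarrow> search_step E d S d' S' \<Longrightarrow> orients d' G"
  unfolding search_step_def by (elim disjE bexE conjE) (simp_all add: orients_flip)

lemma orients_ends: "orients d G \<Longrightarrow> e \<in> edges G \<Longrightarrow> ends G e = {fst (d e), snd (d e)}"
  unfolding orients_def by (rule bspec)

lemma orients_verts:
  assumes "multigraph G" "orients d G"
  shows "d ` edges G \<subseteq> verts G \<times> verts G"
proof (rule image_subsetI)
  fix e assume e: "e \<in> edges G"
  then have "ends G e \<subseteq> verts G" using assms(1) unfolding multigraph_def by blast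
  then show "d e \<in> verts G \<times> verts G"
    unfolding orients_ends[OF assms(2) e] mem_Times_iff by simp
qed

lemma exists_orientation:
  assumes "multigraph G"
  shows "\<exists>d. orients d G"
proof -
  have "\<forall>e. \<exists>p. e \<in> edges G \<longrightarrow> ends G e = {fst p, snd p}"
  proof
    fix e
    show "\<exists>p. e \<in> edges G \<longrightarrow> ends G e = {fst p, snd p}"
    proof (cases "e \<in> edges G")
      case True
      then have "card (ends G e) = 2" using assms unfolding multigraph_def by blast
      then obtain x y where "ends G e = {x, y}" unfolding card_2_iff by blast
      then show ?thesis by (intro exI[of _ "(x, y)"]) simp
    qed blast
  qed
  from choice[OF this] show ?thesis unfolding orients_def by blast
qed

lemma search_terminates:
  assumes G: "multigraph G" and "orients d G" "search_inv (edges G) d S"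
  shows "\<exists>d' S'. orients d' G \<and> search_inv (edges G) d' S' \<and> search_step (edges G) d' S' d' S'"
  using assms(2,3)
proof (induction "potential (verts G) (edges G) d S" arbitrary: d S rule: less_induct)
  case less
  obtain d' S' where step: "search_step (edges G) d S d' S'"
    unfolding search_step_def by metis
  show ?case
  proof (cases "d' = d \<and> S' = S")
    case True
    then show ?thesis using less.prems step by blast
  next
    case False
    have "potential (verts G) (edges G) d' S' < potential (verts G) (edges G) d S"
      using G orients_verts[OF G less.prems(1)] less.prems step False
      by (intro search_step_potential) (auto simp: multigraph_def)
    then show ?thesis
      using less.hyps search_step_orients[OF less.prems(1) step] search_step_inv[OF less.prems(2) step]
      by blast
  qed
qed

section \<open>Optimality of the final orientation\<close>

lemma good_two_detachmentI:
  assumes d: "orients d G" and dV: "d ` edges G \<subseteq> verts G \<times> verts G"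
    and H: "verts H = verts G \<times> UNIV" "edges H = edges G"
      "\<And>e. e \<in> edges G \<Longrightarrow> ends H e = {fst (arc (d e)), snd (arc (d e))}"
    and conn: "(verts G \<times> UNIV) \<times> (verts G \<times> UNIV) \<subseteq> reach (edges G) d {}"
  shows "good_two_detachment G H"
proof -
  let ?R = "{(x, y). \<exists>e\<in>edges H. ends H e = {x, y}}"
  have "two_detachment G H"
    unfolding two_detachment_def
  proof (intro conjI ballI)
    fix e assume e: "e \<in> edges G"
    show "\<exists>u v i j. ends G e = {u, v} \<and> ends H e = {(u, i), (v, j)}"
      using orients_ends[OF d e] H(3)[OF e] unfolding arc_def fst_conv snd_conv by blast
  qed (rule H)+
  moreover have "connected_graph H"
    unfolding connected_graph_def
  proof (intro ballI)
    fix x y assume "x \<in> verts H" "y \<in> verts H"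
    then have "(x, y) \<in> eqcl ((\<lambda>e. arc (d e)) ` (edges G - {}))"
      using conn unfolding H(1) reach_def by blast
    then show "(x, y) \<in> ?R\<^sup>*"
    proof (induction rule: eqcl_induct)
      case (step y z)
      then obtain e where e: "e \<in> edges G" "arc (d e) = (y, z)" by auto
      then have "ends H e = {y, z}" using H(3)[OF e(1)] by simp
      then have "(y, z) \<in> ?R" using e(1) H(2) by blast
      with step.IH show ?case by (rule rtrancl_into_rtrancl)
    next
      case (step_sym y z)
      then obtain e where e: "e \<in> edges G" "arc (d e) = (z, y)" by auto
      then have "ends H e = {y, z}" using H(3)[OF e(1)] by (simp add: insert_commute)
      then have "(y, z) \<in> ?R" using e(1) H(2) by blast
      with step_sym.IH show ?case by (rule rtrancl_into_rtrancl)
    qed simp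
  qed
  moreover have "bipartition H (verts G \<times> {False}) (verts G \<times> {True})"
    unfolding bipartition_def
  proof (intro conjI ballI)
    show "verts H = verts G \<times> {False} \<union> verts G \<times> {True}"
      unfolding H(1) UNIV_bool by blast
    show "(verts G \<times> {False}) \<inter> (verts G \<times> {True}) = {}" by blast
    fix e assume "e \<in> edges H"
    then have e: "e \<in> edges G" unfolding H(2) .
    then have "fst (d e) \<in> verts G" "snd (d e) \<in> verts G" using dV by (auto simp: mem_Times_iff)
    then show "\<exists>a\<in>verts G \<times> {False}. \<exists>b\<in>verts G \<times> {True}. ends H e = {a, b}"
      unfolding H(3)[OF e] arc_def fst_conv snd_conv by blast
  qed
  ultimately show ?thesis unfolding good_two_detachment_def by blast
qed

text \<open>The prescribed bipartition makes every edge join some \<open>(u, False)\<close> to some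
  \<open>(v, True)\<close>, and orienting it from \<open>u\<close> to \<open>v\<close> gives
  \<open>d\<close>.\<close>

lemma good_two_detachmentE:
  assumes "good_two_detachment G H"
  obtains d where "orients d G"
    "(verts G \<times> UNIV) \<times> (verts G \<times> UNIV) \<subseteq> reach (edges G) d {}"
proof -
  have H: "verts H = verts G \<times> UNIV" "edges H = edges G" and conn: "connected_graph H"
    and bip: "bipartition H (verts G \<times> {False}) (verts G \<times> {True})"
    and ends: "\<And>e. e \<in> edges G \<Longrightarrow> \<exists>u v i j. ends G e = {u, v} \<and> ends H e = {(u, i), (v, j)}"
    using assms unfolding good_two_detachment_def two_detachment_def by blast+
  have "\<forall>e. \<exists>p. e \<in> edges G \<longrightarrow> ends G e = {fst p, snd p} \<and> ends H e = {fst (arc p), snd (arc p)}"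
  proof
    fix e
    show "\<exists>p. e \<in> edges G \<longrightarrow> ends G e = {fst p, snd p} \<and> ends H e = {fst (arc p), snd (arc p)}"
    proof (cases "e \<in> edges G")
      case True
      then obtain u v where uv: "ends H e = {(u, False), (v, True)}"
        using bip unfolding bipartition_def H(2) by blast
      obtain u' v' i j where "ends G e = {u', v'}" "ends H e = {(u', i), (v', j)}"
        using ends[OF True] by blast
      \<comment> \<open>The detachment may name the two ends in either order; projecting away the
        copies makes this irrelevant.\<close>
      then have "ends G e = fst ` ends H e" by simp
      then have "ends G e = {u, v}" unfolding uv by simp
      then show ?thesis using uv by (intro exI[of _ "(u, v)"]) (simp add: arc_def)
    qed blast
  qed
  from choice[OF this] obtain d where
    d: "\<And>e. e \<in> edges G \<Longrightarrow> ends G e = {fst (d e), snd (d e)}"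
       "\<And>e. e \<in> edges G \<Longrightarrow> ends H e = {fst (arc (d e)), snd (arc (d e))}" by blast
  have "(x, y) \<in> reach (edges G) d {}" if "x \<in> verts H" "y \<in> verts H" for x y
  proof -
    have "(x, y) \<in> {(x, y). \<exists>e\<in>edges H. ends H e = {x, y}}\<^sup>*"
      using conn that unfolding connected_graph_def by blast
    then show ?thesis
    proof (induction rule: rtrancl_induct)
      case base
      then show ?case by (simp add: reach_def)
    next
      case (step y z)
      then obtain e where e: "e \<in> edges G" "ends H e = {y, z}" using H(2) by auto
      have "arc (d e) \<in> reach (edges G) d {}" by (rule arc_in_reach[OF e(1)]) simp
      moreover have "arc (d e) = (y, z) \<or> arc (d e) = (z, y)"
        using d(2)[OF e(1)] e(2) by (cases "arc (d e)") (auto simp: doubleton_eq_iff)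
      ultimately have "(y, z) \<in> reach (edges G) d {}" unfolding reach_def using eqcl_sym by metis
      with step.IH show ?case unfolding reach_def by (rule eqcl_trans)
    qed
  qed
  then have "(verts G \<times> UNIV) \<times> (verts G \<times> UNIV) \<subseteq> reach (edges G) d {}"
    unfolding H(1) by auto
  then show ?thesis using that d(1) unfolding orients_def by blast
qed

section \<open>The partition obtained when the search stops\<close>

definition classes :: "'v set \<Rightarrow> ('v \<times> 'v) set \<Rightarrow> 'v set set" where
  "classes V R = (\<lambda>u. {v \<in> V. (u, v) \<in> R}) ` V"

lemma partition_on_classes: "partition_on V (classes V (eqcl A))"
proof (rule partition_onI)
  show "\<Union>(classes V (eqcl A)) = V" unfolding classes_def using eqcl_refl[of _ A] by fast
next
  show "{} \<notin> classes V (eqcl A)" unfolding classes_def using eqcl_refl[of _ A] by fast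
next
  fix p q assume p: "p \<in> classes V (eqcl A)" and q: "q \<in> classes V (eqcl A)" and ne: "p \<noteq> q"
  obtain x y where x: "p = {v \<in> V. (x, v) \<in> eqcl A}" and y: "q = {v \<in> V. (y, v) \<in> eqcl A}"
    using p q unfolding classes_def by blast
  show "disjnt p q"
  proof (rule ccontr)
    assume "\<not> disjnt p q"
    then obtain z where z: "(x, z) \<in> eqcl A" "(y, z) \<in> eqcl A" unfolding disjnt_def x y by blast
    have "eqcl A `` {x} = eqcl A `` {y}"
      using z[folded eqcl_class_eq_iff] by simp
    then have "p = q" unfolding x y by blast
    then show False using ne by simp
  qed
qed

text \<open>Delete the bridges one after another. A bridge of the whole graph remains a bridge after
  other deletions, so each deletion creates a new component.\<close>

lemma card_bridges:
  assumes fin: "finite V" "finite E" and dV: "d ` E \<subseteq> V \<times> V"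
    and S: "S \<subseteq> E" "\<forall>e\<in>S. \<not> nonbridge E d e"
  shows "card S + comps (V \<times> UNIV) (reach E d {}) \<le> comps (V \<times> UNIV) (reach E d S)"
proof -
  have "finite S" using S(1) fin(2) by (rule finite_subset)
  then show ?thesis using S
  proof (induction S rule: finite_induct)
    case empty
    then show ?case by simp
  next
    case (insert e S)
    have e: "e \<in> E" "\<not> nonbridge E d e" using insert.prems by auto
    have uv: "fst (d e) \<in> V" "snd (d e) \<in> V" using dV e(1) by (auto simp: mem_Times_iff)
    have "comps (V \<times> UNIV) (reach E d S) < comps (V \<times> UNIV) (reach E d (insert e S))"
      unfolding reach_def
    proof (rule comps_less)
      show "finite (V \<times> (UNIV :: bool set))" using fin by simp
      show "(fst (d e), False) \<in> V \<times> UNIV" "(snd (d e), True) \<in> V \<times> UNIV" using uv by simp_all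
      show "(\<lambda>e. arc (d e)) ` (E - insert e S) \<subseteq> eqcl ((\<lambda>e. arc (d e)) ` (E - S))"
        by (rule subsetI, rule eqcl_base) blast
      show "((fst (d e), False), (snd (d e), True)) \<in> eqcl ((\<lambda>e. arc (d e)) ` (E - S))"
        using arc_in_reach[OF e(1) insert.hyps(2), of d] unfolding reach_def arc_def .
      have "reach E d (insert e S) \<subseteq> reach E d {e}" by (rule reach_antimono) blast
      then show "((fst (d e), False), (snd (d e), True)) \<notin> eqcl ((\<lambda>e. arc (d e)) ` (E - insert e S))"
        using e(2) unfolding nonbridge_def reach_def arc_def by blast
    qed
    moreover have "card S + comps (V \<times> UNIV) (reach E d {}) \<le> comps (V \<times> UNIV) (reach E d S)"
      using insert by simp
    ultimately show ?case using insert.hyps by simp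
  qed
qed

text \<open>Outside \<open>S\<close> both arcs of an edge lie inside components, so every step of a
  path can be lifted from either copy and changes the copy. The final copy \<open>j\<close> depends
  on the parity of the path.\<close>

lemma lift_path:
  assumes "crossing E d S \<subseteq> S" "(u, v) \<in> eqcl (d ` (E - S))"
  shows "\<exists>j. ((u, i), (v, j)) \<in> reach E d S"
  using assms(2)
proof (induction rule: eqcl_induct)
  case refl
  show ?case unfolding reach_def by (rule exI, rule eqcl_refl)
next
  case (step y z)
  then obtain e where e: "e \<in> E - S" "d e = (y, z)" by auto
  then have "((y, False), (z, True)) \<in> reach E d S" "((z, False), (y, True)) \<in> reach E d S"
    using assms(1) by (auto simp: crossing_def arc_def)
  then have "((y, k), (z, \<not> k)) \<in> reach E d S" for k
    unfolding reach_def by (cases k) (simp_all add: eqcl_sym)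
  moreover obtain j where "((u, i), (y, j)) \<in> reach E d S" using step.IH by blast
  ultimately have "((u, i), (z, \<not> j)) \<in> reach E d S" unfolding reach_def by (meson eqcl_trans)
  then show ?case by (rule exI)
next
  case (step_sym y z)
  then obtain e where e: "e \<in> E - S" "d e = (z, y)" by auto
  then have "((z, False), (y, True)) \<in> reach E d S" "((y, False), (z, True)) \<in> reach E d S"
    using assms(1) by (auto simp: crossing_def arc_def)
  then have "((y, k), (z, \<not> k)) \<in> reach E d S" for k
    unfolding reach_def by (cases k) (simp_all add: eqcl_sym)
  moreover obtain j where "((u, i), (y, j)) \<in> reach E d S" using step_sym.IH by blast
  ultimately have "((u, i), (z, \<not> j)) \<in> reach E d S" unfolding reach_def by (meson eqcl_trans)
  then show ?case by (rule exI)
qed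

text \<open>The components of the double cover of \<open>(V, E - S)\<close> lying over a part \<open>X\<close> are one or two in
  number. If there are two and no edge of \<open>S\<close> lies inside \<open>X\<close>, they provide a 2-colouring of \<open>G[X]\<close>.\<close>

lemma comps_double_cover:
  assumes G: "multigraph G" "orients d G" and S: "S \<subseteq> edges G" "crossing (edges G) d S \<subseteq> S"
    and Q: "Q = classes (verts G) (eqcl (d ` (edges G - S)))"
  shows "comps (verts G \<times> UNIV) (reach (edges G) d S) \<le>
    card Q + bip_parts G Q + card {e \<in> S. \<exists>X\<in>Q. ends G e \<subseteq> X}"
proof -
  let ?V = "verts G" and ?E = "edges G"
  let ?R = "reach ?E d S" and ?T = "eqcl (d ` (?E - S))"
  have fin: "finite ?V" "finite ?E" using G(1) unfolding multigraph_def by simp_all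
  note dV = orients_verts[OF G]
  have finQ: "finite Q" unfolding Q classes_def using fin by simp
  have part: "partition_on ?V Q" unfolding Q by (rule partition_on_classes)
  have R_sym: "(x, y) \<in> ?R \<Longrightarrow> (y, x) \<in> ?R" and R_refl: "(x, x) \<in> ?R"
    and R_trans: "(x, y) \<in> ?R \<Longrightarrow> (y, z) \<in> ?R \<Longrightarrow> (x, z) \<in> ?R" for x y z
    unfolding reach_def by (fact eqcl_sym, fact eqcl_refl, fact eqcl_trans)
  have X_T: "(u, v) \<in> ?T" if X: "X \<in> Q" "u \<in> X" "v \<in> X" for X u v
  proof -
    obtain x where "X = {v \<in> ?V. (x, v) \<in> ?T}" using X(1) unfolding Q classes_def by blast
    then have "(x, u) \<in> ?T" "(x, v) \<in> ?T" using X(2,3) by blast+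
    then show ?thesis by (meson eqcl_sym eqcl_trans)
  qed
  define r where "r X = (SOME x. x \<in> X)" for X :: "'a set"
  have r: "r X \<in> X" if "X \<in> Q" for X
    using partition_onD3[OF part] that unfolding r_def by (metis some_in_eq)
  \<comment> \<open>Every copy of a vertex of \<open>X\<close> reaches at least one copy of
    \<open>v\<close>. If some copy reaches both, the copies of \<open>v\<close> are joined.\<close>
  have other: "((v, True), (v, False)) \<in> ?R \<or> (\<forall>u\<in>X. \<forall>i. (((u, i), (v, False)) \<in> ?R) \<noteq> (((u, i), (v, True)) \<in> ?R))"
    if X: "X \<in> Q" "v \<in> X" for X v
  proof (rule disjCI)
    assume ne: "\<not> (\<forall>u\<in>X. \<forall>i. (((u, i), (v, False)) \<in> ?R) \<noteq> (((u, i), (v, True)) \<in> ?R))"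
    then obtain u i where u: "u \<in> X" and
      "(((u, i), (v, False)) \<in> ?R) = (((u, i), (v, True)) \<in> ?R)" by blast
    moreover obtain j where "((u, i), (v, j)) \<in> ?R"
      using lift_path[OF S(2) X_T[OF X(1) u X(2)], of i] by blast
    ultimately have "((u, i), (v, False)) \<in> ?R" "((u, i), (v, True)) \<in> ?R" by (cases j; simp)+
    then show "((v, True), (v, False)) \<in> ?R" by (meson R_sym R_trans)
  qed
  \<comment> \<open>The parts over which there are two components. All components are met by the
    \<open>False\<close> copies of representatives and, for parts in \<open>D\<close>, the
    \<open>True\<close> copies.\<close>
  define D where "D = {X \<in> Q. ((r X, True), (r X, False)) \<notin> ?R}"
  let ?c = "\<lambda>x. ?R `` {x}"
  have "?c ` (?V \<times> UNIV) \<subseteq> (\<lambda>X. ?c (r X, False)) ` Q \<union> (\<lambda>X. ?c (r X, True)) ` D"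
  proof (rule image_subsetI)
    fix x :: "'a \<times> bool" assume "x \<in> ?V \<times> UNIV"
    then obtain u i where x: "x = (u, i)" and "u \<in> ?V" by blast
    then obtain X where X: "X \<in> Q" "u \<in> X" using partition_onD1[OF part] by blast
    obtain j where "((u, i), (r X, j)) \<in> ?R"
      using lift_path[OF S(2) X_T[OF X r[OF X(1)]], of i] by blast
    then have c: "?c x = ?c (r X, j)" unfolding x reach_def eqcl_class_eq_iff .
    show "?c x \<in> (\<lambda>X. ?c (r X, False)) ` Q \<union> (\<lambda>X. ?c (r X, True)) ` D"
    proof (cases "j \<and> X \<in> D")
      case True
      then show ?thesis using c by (intro UnI2 image_eqI[of _ _ X]) simp_all
    next
      case False
      then have "?c (r X, j) = ?c (r X, False)"
        using X(1) unfolding D_def reach_def eqcl_class_eq_iff by (cases j) simp_all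
      then show ?thesis using c X(1) by (intro UnI1 image_eqI[of _ _ X]) simp_all
    qed
  qed
  then have "comps (?V \<times> UNIV) ?R \<le> card ((\<lambda>X. ?c (r X, False)) ` Q \<union> (\<lambda>X. ?c (r X, True)) ` D)"
    unfolding comps_def using finQ by (intro card_mono) (simp_all add: D_def)
  also have "\<dots> \<le> card ((\<lambda>X. ?c (r X, False)) ` Q) + card ((\<lambda>X. ?c (r X, True)) ` D)"
    by (rule card_Un_le)
  also have "\<dots> \<le> card Q + card D"
    using finQ by (intro add_mono card_image_le) (simp_all add: D_def)
  finally have 1: "comps (?V \<times> UNIV) ?R \<le> card Q + card D" .
  let ?B = "{X \<in> Q. bipartite (induced G X)}" and ?I = "{e \<in> S. \<exists>X\<in>Q. ends G e \<subseteq> X}"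
  have inside: "\<exists>e. e \<in> S \<and> ends G e \<subseteq> X" if X: "X \<in> D - ?B" for X
  proof (rule ccontr)
    assume no: "\<nexists>e. e \<in> S \<and> ends G e \<subseteq> X"
    have XQ: "X \<in> Q" and ne: "((r X, True), (r X, False)) \<notin> ?R" using X unfolding D_def by blast+
    \<comment> \<open>The colour of \<open>u\<close> says which of its copies lies in the component
      of \<open>(r X, False)\<close>. An edge outside \<open>S\<close> joins opposite copies of its
      ends, hence opposite colours.\<close>
    let ?A = "{u \<in> X. ((u, False), (r X, False)) \<in> ?R}"
    let ?A' = "{u \<in> X. ((u, True), (r X, False)) \<in> ?R}"
    have fwd: "(((u, i), (r X, False)) \<in> ?R) \<noteq> (((u, i), (r X, True)) \<in> ?R)" if "u \<in> X" for u i
      using other[OF XQ r[OF XQ]] ne that by blast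
    have "bipartition (induced G X) ?A ?A'"
      unfolding bipartition_def
    proof (intro conjI ballI)
      have "u \<in> ?A \<union> ?A'" if u: "u \<in> X" for u
      proof -
        obtain j where "((r X, False), (u, j)) \<in> ?R"
          using lift_path[OF S(2) X_T[OF XQ r[OF XQ] u], of False] by blast
        then have "((u, j), (r X, False)) \<in> ?R" by (rule R_sym)
        then show ?thesis using u by (cases j) simp_all
      qed
      then show "verts (induced G X) = ?A \<union> ?A'" unfolding induced_def by auto
      show "?A \<inter> ?A' = {}"
      proof (rule ccontr)
        assume "?A \<inter> ?A' \<noteq> {}"
        then obtain u where u: "u \<in> X" "((u, False), (r X, False)) \<in> ?R" "((u, True), (r X, False)) \<in> ?R"
          by blast
        obtain j where "((r X, True), (u, j)) \<in> ?R"
          using lift_path[OF S(2) X_T[OF XQ r[OF XQ] u(1)], of True] by blast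
        moreover have "((u, j), (r X, False)) \<in> ?R" using u by (cases j) simp_all
        ultimately show False using ne R_trans by blast
      qed
      fix e assume "e \<in> edges (induced G X)"
      then have e: "e \<in> ?E" "ends G e \<subseteq> X" unfolding induced_def by simp_all
      then have "e \<notin> S" using no by blast
      obtain u v where uv: "d e = (u, v)" by (rule prod.exhaust)
      have "((u, False), (v, True)) \<in> ?R" "((v, False), (u, True)) \<in> ?R"
        using S(2) e(1) \<open>e \<notin> S\<close> uv by (auto simp: crossing_def arc_def)
      have ends: "ends G e = {u, v}" using orients_ends[OF G(2) e(1)] uv by simp
      then have "u \<in> X" "v \<in> X" using e(2) by simp_all
      then have "u \<in> ?A \<union> ?A'"
        using \<open>\<And>u. u \<in> X \<Longrightarrow> u \<in> ?A \<union> ?A'\<close> by blast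
      then show "\<exists>a\<in>?A. \<exists>b\<in>?A'. ends (induced G X) e = {a, b}"
      proof
        assume u: "u \<in> ?A"
        then have "((v, True), (r X, False)) \<in> ?R"
          using R_trans[OF R_sym[OF \<open>((u, False), (v, True)) \<in> ?R\<close>]] by blast
        then have "v \<in> ?A'" using \<open>v \<in> X\<close> by blast
        with u show ?thesis using ends unfolding induced_def by auto
      next
        assume u: "u \<in> ?A'"
        then have "((v, False), (r X, False)) \<in> ?R"
          using R_trans[OF \<open>((v, False), (u, True)) \<in> ?R\<close>] by blast
        then have "v \<in> ?A" using \<open>v \<in> X\<close> by blast
        moreover have "ends (induced G X) e = {v, u}" using ends unfolding induced_def by auto
        ultimately show ?thesis using u by blast
      qed
    qed
    then show False using X XQ unfolding bipartite_def by blast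
  qed
  then obtain f where f: "\<And>X. X \<in> D - ?B \<Longrightarrow> f X \<in> S \<and> ends G (f X) \<subseteq> X" by metis
  \<comment> \<open>Distinct parts are disjoint and every edge has an end, so no edge lies inside
    two of them.\<close>
  have "inj_on f (D - ?B)"
  proof (rule inj_onI)
    fix X Y assume X: "X \<in> D - ?B" and Y: "Y \<in> D - ?B" and eq: "f X = f Y"
    have "f X \<in> ?E" using f[OF X] S(1) by blast
    then have "ends G (f X) \<noteq> {}" using orients_ends[OF G(2)] by simp
    then have "X \<inter> Y \<noteq> {}" using f[OF X] f[OF Y] eq by auto
    then show "X = Y" using X Y partition_onD2[OF part] unfolding D_def disjoint_def by blast
  qed
  moreover have "f ` (D - ?B) \<subseteq> ?I"
  proof (rule image_subsetI)
    fix X assume X: "X \<in> D - ?B"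
    then have "X \<in> Q" unfolding D_def by blast
    then show "f X \<in> ?I" using f[OF X] by blast
  qed
  moreover have "finite ?I" using finite_subset[OF S(1) fin(2)] by simp
  ultimately have "card (D - ?B) \<le> card ?I" by (rule card_inj_on_le)
  moreover have "card D \<le> card ?B + card (D - ?B)"
  proof -
    have "card D \<le> card (?B \<union> (D - ?B))"
      using finQ by (intro card_mono) (auto simp: D_def)
    also have "\<dots> \<le> card ?B + card (D - ?B)" by (rule card_Un_le)
    finally show ?thesis .
  qed
  ultimately show ?thesis using 1 unfolding bip_parts_def by linarith
qed

text \<open>Let \<open>I\<close> be the edges of \<open>S\<close> inside parts and \<open>c\<close>
  the number of components of \<open>H\<close>. Then \<open>e(Q) <= |S| - |I|\<close> and
  \<open>|S| + c <= |Q| + b(Q) + |I|\<close>, by \<open>card_bridges\<close> and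
  \<open>comps_double_cover\<close>. With \<open>c >= 2\<close> this yields
  \<open>e(Q) <= |Q| + b(Q) - 2\<close>.\<close>

lemma search_fixpoint_violates:
  assumes G: "multigraph G" "orients d G"
    and S: "S \<subseteq> edges G" "crossing (edges G) d S \<subseteq> S" "\<forall>e\<in>S. \<not> nonbridge (edges G) d e"
    and disc: "\<not> (verts G \<times> UNIV) \<times> (verts G \<times> UNIV) \<subseteq> reach (edges G) d {}"
  shows "\<not> partition_condition G (classes (verts G) (eqcl (d ` (edges G - S))))"
proof -
  let ?V = "verts G" and ?E = "edges G" and ?T = "eqcl (d ` (edges G - S))"
  let ?Q = "classes ?V ?T"
  have fin: "finite ?V" "finite ?E" using G(1) unfolding multigraph_def by simp_all
  note dV = orients_verts[OF G]
  have part: "partition_on ?V ?Q" by (rule partition_on_classes)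
  have uniq: "X = Y" if "X \<in> ?Q" "Y \<in> ?Q" "u \<in> X" "u \<in> Y" for X Y u
    using partition_onD2[OF part] that unfolding disjoint_def by blast
  let ?I = "{e \<in> S. \<exists>X\<in>?Q. ends G e \<subseteq> X}"
  let ?C = "{e \<in> ?E. \<exists>X\<in>?Q. \<exists>Y\<in>?Q. X \<noteq> Y \<and> (\<exists>u\<in>X. \<exists>v\<in>Y. ends G e = {u, v})}"
  have "?C \<subseteq> S - ?I"
  proof
    fix e assume "e \<in> ?C"
    then obtain X Y u v where e: "e \<in> ?E" and X: "X \<in> ?Q" "Y \<in> ?Q" "X \<noteq> Y" "u \<in> X" "v \<in> Y"
      and uv: "ends G e = {u, v}" by blast
    have "\<not> ends G e \<subseteq> Z" if "Z \<in> ?Q" for Z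
    proof
      assume "ends G e \<subseteq> Z"
      then have "u \<in> Z" "v \<in> Z" unfolding uv by simp_all
      then show False using uniq[OF X(1) that X(4)] uniq[OF X(2) that X(5)] X(3) by blast
    qed
    moreover have "\<exists>Z\<in>?Q. ends G e \<subseteq> Z" if "e \<notin> S"
    proof -
      have "d e \<in> ?T" using e that by (intro eqcl_base) blast
      moreover have "d e \<in> ?V \<times> ?V" using dV e by blast
      ultimately have "ends G e \<subseteq> {v \<in> ?V. (fst (d e), v) \<in> ?T}"
        unfolding orients_ends[OF G(2) e] by (auto simp: mem_Times_iff)
      moreover have "{v \<in> ?V. (fst (d e), v) \<in> ?T} \<in> ?Q"
        unfolding classes_def using \<open>d e \<in> ?V \<times> ?V\<close> by (auto simp: mem_Times_iff)
      ultimately show ?thesis by blast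
    qed
    ultimately show "e \<in> S - ?I" by blast
  qed
  moreover have "finite S" using S(1) fin(2) by (rule finite_subset)
  ultimately have "cross_edges G ?Q \<le> card S - card ?I"
    unfolding cross_edges_def using card_mono[of "S - ?I" ?C] card_Diff_subset[of ?I S] by simp
  moreover have "card ?I \<le> card S" using \<open>finite S\<close> by (intro card_mono) auto
  moreover have "comps (?V \<times> UNIV) (reach ?E d {}) > 1"
    using comps_le_1_iff[of "?V \<times> (UNIV :: bool set)"] disc fin unfolding reach_def by fastforce
  moreover note card_bridges[OF fin dV S(1,3)]
    comps_double_cover[OF G S(1,2) refl]
  ultimately show ?thesis unfolding partition_condition_def by linarith
qed

text \<open>A labelling of the copies, constant along edges inside parts, takes
  \<open>|Q| + b(Q)\<close> values. So at least that many components remain without the crossing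
  edges, and restoring each of those edges removes at most one.\<close>

lemma good_two_detachment_necessary:
  assumes G: "multigraph G" and H: "good_two_detachment G H" and Q: "partition_on (verts G) Q"
  shows "partition_condition G Q"
proof -
  let ?V = "verts G" and ?E = "edges G"
  obtain d where d: "orients d G" and conn: "(?V \<times> UNIV) \<times> (?V \<times> UNIV) \<subseteq> reach ?E d {}"
    using good_two_detachmentE[OF H] .
  have fin: "finite ?V" "finite ?E" using G unfolding multigraph_def by simp_all
  note dV = orients_verts[OF G d]
  let ?W = "?V \<times> (UNIV :: bool set)"
  let ?C = "{e \<in> ?E. \<exists>X\<in>Q. \<exists>Y\<in>Q. X \<noteq> Y \<and> (\<exists>u\<in>X. \<exists>v\<in>Y. ends G e = {u, v})}"
  let ?a = "\<lambda>e. arc (d e)"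
  have finW: "finite ?W" using fin by simp
  have finQ: "finite Q" using Q fin(1) by (rule finite_elements[rotated])
  have uniq: "X = Y" if "X \<in> Q" "Y \<in> Q" "u \<in> X" "u \<in> Y" for X Y u
    using partition_onD2[OF Q] that unfolding disjoint_def by blast
  have "\<forall>X. \<exists>A. bipartite (induced G X) \<longrightarrow> (\<exists>B. bipartition (induced G X) A B)"
    unfolding bipartite_def by blast
  from choice[OF this] obtain A where A: "\<And>X. bipartite (induced G X) \<Longrightarrow> \<exists>B. bipartition (induced G X) (A X) B"
    by blast
  define p where "p v = (THE X. X \<in> Q \<and> v \<in> X)" for v
  have p: "p v = X" if "X \<in> Q" "v \<in> X" for X v
    unfolding p_def using that uniq by (intro the_equality) blast+
  \<comment> \<open>An edge inside a bipartite part changes both the colour class and the copy, so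
    the exclusive or of the two bits is constant along it.\<close>
  define l where "l x = (p (fst x), bipartite (induced G (p (fst x))) \<and> (fst x \<in> A (p (fst x))) \<noteq> snd x)"
    for x :: "'a \<times> bool"
  have l_arc: "l x = l y" if xyC: "(x, y) \<in> ?a ` (?E - ?C)" for x y
  proof -
    obtain e where e: "e \<in> ?E" "e \<notin> ?C" "(x, y) = ?a e" using xyC by blast
    obtain u v where uv: "d e = (u, v)" by (rule prod.exhaust)
    have xy: "x = (u, False)" "y = (v, True)" using e(3) uv by (simp_all add: arc_def)
    have "u \<in> ?V" "v \<in> ?V" using dV e(1) uv by auto
    then obtain X Y where X: "X \<in> Q" "u \<in> X" "Y \<in> Q" "v \<in> Y" using partition_onD1[OF Q] by blast
    have ends: "ends G e = {u, v}" using orients_ends[OF d e(1)] uv by simp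
    have "X = Y" using e(1,2) X ends by blast
    then have p: "p u = X" "p v = X" using p X by blast+
    have "(u \<in> A X) \<noteq> (v \<in> A X)" if bip: "bipartite (induced G X)"
    proof -
      obtain B where B: "bipartition (induced G X) (A X) B" using A[OF bip] by blast
      have "e \<in> edges (induced G X)" unfolding induced_def using e(1) ends X \<open>X = Y\<close> by simp
      then obtain a b where "a \<in> A X" "b \<in> B" "{u, v} = {a, b}"
        using B ends unfolding bipartition_def induced_def by auto
      moreover have "A X \<inter> B = {}" using B unfolding bipartition_def by blast
      ultimately show ?thesis unfolding doubleton_eq_iff by blast
    qed
    then show ?thesis unfolding l_def xy fst_conv snd_conv p by blast
  qed
  have "(\<lambda>X. (X, False)) ` Q \<union> (\<lambda>X. (X, True)) ` {X \<in> Q. bipartite (induced G X)} \<subseteq> l ` ?W"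
  proof -
    have mem: "(X, b) \<in> l ` ?W" if X: "X \<in> Q" and b: "b \<longrightarrow> bipartite (induced G X)" for X b
    proof -
      obtain v where v: "v \<in> X" using partition_onD3[OF Q] X by fastforce
      then have "v \<in> ?V" using partition_onD1[OF Q] X by blast
      \<comment> \<open>In a bipartite part, the copy of \<open>v\<close> is chosen so that the
        exclusive or in \<open>l\<close> evaluates to \<open>b\<close>.\<close>
      then show ?thesis using p[OF X v] b
        by (intro image_eqI[of _ _ "(v, (v \<in> A X) \<noteq> b)"]) (auto simp: l_def)
    qed
    show ?thesis by (intro Un_least image_subsetI mem) simp_all
  qed
  then have "card ((\<lambda>X. (X, False)) ` Q \<union> (\<lambda>X. (X, True)) ` {X \<in> Q. bipartite (induced G X)}) \<le> card (l ` ?W)"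
    using finW by (intro card_mono) simp_all
  moreover have "card ((\<lambda>X. (X, False)) ` Q \<union> (\<lambda>X. (X, True)) ` {X \<in> Q. bipartite (induced G X)}) =
      card Q + bip_parts G Q"
    unfolding bip_parts_def using finQ
    by (subst card_Un_disjoint) (auto simp: card_image inj_on_def)
  moreover have "card (l ` ?W) \<le> comps ?W (eqcl (?a ` (?E - ?C)))"
    by (rule card_image_le_comps[OF finW]) (fact l_arc)
  moreover have "comps ?W (eqcl (?a ` (?E - ?C))) \<le> comps ?W (eqcl (?a ` (?E - ?C) \<union> ?a ` ?C)) + card (?a ` ?C)"
    using fin by (intro comps_Un finW) simp
  moreover have "?a ` (?E - ?C) \<union> ?a ` ?C = ?a ` (?E - {})" by blast
  moreover have "comps ?W (eqcl (?a ` (?E - {}))) \<le> 1"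
    unfolding comps_le_1_iff[OF finW] using conn unfolding reach_def .
  moreover have "card (?a ` ?C) \<le> cross_edges G Q"
    unfolding cross_edges_def using fin by (intro card_image_le) simp
  ultimately have "card Q + bip_parts G Q \<le> 1 + cross_edges G Q" by simp
  then show ?thesis unfolding partition_condition_def by linarith
qed

theorem good_two_detachment_iff:
  fixes G :: "('a, 'b) mgraph"
  assumes G: "multigraph G"
  shows "(\<exists>H. good_two_detachment G H) \<longleftrightarrow> (\<forall>Q. partition_on (verts G) Q \<longrightarrow> partition_condition G Q)"
proof
  assume "\<exists>H. good_two_detachment G H"
  then show "\<forall>Q. partition_on (verts G) Q \<longrightarrow> partition_condition G Q"
    using good_two_detachment_necessary[OF G] by blast
next
  assume cond: "\<forall>Q. partition_on (verts G) Q \<longrightarrow> partition_condition G Q"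
  obtain d0 where d0: "orients d0 G" using exists_orientation[OF G] by blast
  have "search_inv (edges G) d0 {}" unfolding search_inv_def by (auto intro: exI[of _ 0])
  from search_terminates[OF G d0 this] obtain d S where
    d: "orients d G" and inv: "search_inv (edges G) d S" and step: "search_step (edges G) d S d S"
    by (elim exE conjE)
  have S: "S \<subseteq> edges G" "\<forall>e\<in>S. \<not> nonbridge (edges G) d e"
    using inv unfolding search_inv_def by (auto simp: level_subset[THEN subsetD])
  have cr: "crossing (edges G) d S \<subseteq> S"
  proof -
    \<comment> \<open>Without loops a reversal always changes the orientation, so a fixed point of
      the search must come from the growing alternative and satisfies
      \<open>S = crossing (edges G) d S\<close>.\<close>
    have "flip d e \<noteq> d" if "e \<in> edges G" for e
    proof
      assume "flip d e = d"
      then have "prod.swap (d e) = d e" unfolding flip_def by (metis fun_upd_same)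
      then have "fst (d e) = snd (d e)" by (metis fst_swap)
      moreover have "card (ends G e) = 2" using G that unfolding multigraph_def by blast
      ultimately show False using orients_ends[OF d that] by simp
    qed
    moreover have "e \<in> edges G" if "e \<in> crossing (edges G) d S" for e
      using that unfolding crossing_def by simp
    ultimately show ?thesis using step unfolding search_step_def by (elim disjE bexE conjE) (metis, simp)
  qed
  have "(verts G \<times> UNIV) \<times> (verts G \<times> UNIV) \<subseteq> reach (edges G) d {}"
    using search_fixpoint_violates[OF G d S(1) cr S(2)] cond partition_on_classes by blast
  from good_two_detachmentI[OF d orients_verts[OF G d] _ _ _ this]
  show "\<exists>H. good_two_detachment G H"
    by (intro exI[of _ "\<lparr>verts = verts G \<times> UNIV, edges = edges G,
      ends = \<lambda>e. {fst (arc (d e)), snd (arc (d e))}\<rparr>"]) simp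
qed

section \<open>The program\<close>

definition merge_labels :: "nat list \<Rightarrow> nat \<times> nat \<Rightarrow> nat list" where
  "merge_labels l p =
     map (\<lambda>x. if x = nth_default 0 l (fst p) then nth_default 0 l (snd p) else x) l"

text \<open>Union-find in its simplest form: every point starts with its own index as label, and
  each pair relabels a whole class.\<close>

definition labels :: "nat \<Rightarrow> (nat \<times> nat) list \<Rightarrow> nat list" where
  "labels N ps = foldl merge_labels [0..<N] ps"

abbreviation edge_at :: "(nat \<times> nat) list \<Rightarrow> nat \<Rightarrow> nat \<times> nat" where
  "edge_at H \<equiv> nth_default (0, 0) H"

text \<open>The vertices \<open>u'\<close> and \<open>u''\<close> of a 2-detachment are numbered \<open>u\<close> and \<open>n + u\<close>.\<close>

definition cover_labels :: "nat \<Rightarrow> (nat \<times> nat) list \<Rightarrow> nat list \<Rightarrow> nat list" where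
  "cover_labels n H S = labels (n + n)
     (map (\<lambda>i. (fst (edge_at H i), n + snd (edge_at H i))) (filter (\<lambda>i. i \<notin> set S) [0..<length H]))"

text \<open>Tests the ends of \<open>arc p\<close>, hence the offset \<open>n\<close> on the second
  component only.\<close>

definition joined :: "nat \<Rightarrow> nat list \<Rightarrow> nat \<times> nat \<Rightarrow> bool" where
  "joined n l p \<longleftrightarrow> nth_default 0 l (fst p) = nth_default 0 l (n + snd p)"

definition crossing_list :: "nat \<Rightarrow> (nat \<times> nat) list \<Rightarrow> nat list \<Rightarrow> nat list" where
  "crossing_list n H S = filter (\<lambda>i. \<not> joined n (cover_labels n H S) (edge_at H i) \<or>
     \<not> joined n (cover_labels n H S) (snd (edge_at H i), fst (edge_at H i))) [0..<length H]"

text \<open>Restricted to the next level: these are exactly the candidates for a reversal.\<close>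

definition nonbridge_list :: "nat \<Rightarrow> (nat \<times> nat) list \<Rightarrow> nat list \<Rightarrow> nat list" where
  "nonbridge_list n H S =
     filter (\<lambda>i. joined n (cover_labels n H [i]) (edge_at H i)) (crossing_list n H S)"

definition flip_at :: "(nat \<times> nat) list \<Rightarrow> nat \<Rightarrow> (nat \<times> nat) list" where
  "flip_at H i = map (\<lambda>j. if j = i then (snd (edge_at H j), fst (edge_at H j)) else edge_at H j)
     [0..<length H]"

type_synonym state = "(nat \<times> nat) list \<times> nat list"

definition step :: "nat \<Rightarrow> state \<Rightarrow> state" where
  "step n s = (if nonbridge_list n (fst s) (snd s) = [] then (fst s, crossing_list n (fst s) (snd s))
     else (flip_at (fst s) (hd_default 0 (nonbridge_list n (fst s) (snd s))), []))"

text \<open>An upper bound on \<open>potential\<close>: at most \<open>n + n\<close> components,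
  \<open>m + 1\<close> bridge levels and \<open>m\<close> edges. The program makes this many steps
  in any case, because a final state persists.\<close>

definition iterations :: "nat \<Rightarrow> nat \<Rightarrow> nat" where
  "iterations n m = ((n + n) * (m + 2) + (m + 1)) * (m + 1) + m"

definition search :: "nat \<Rightarrow> (nat \<times> nat) list \<Rightarrow> state" where
  "search n es = (step n ^^ iterations n (length es)) (es, [])"

definition connected_list :: "nat \<Rightarrow> (nat \<times> nat) list \<Rightarrow> bool" where
  "connected_list n H \<longleftrightarrow>
     filter (\<lambda>i. nth_default 0 (cover_labels n H []) i \<noteq> nth_default 0 (cover_labels n H []) 0)
       [0..<n + n] = []"

definition class_of :: "nat \<Rightarrow> nat list \<Rightarrow> nat \<Rightarrow> nat list" where
  "class_of n l u = filter (\<lambda>v. nth_default 0 l u = nth_default 0 l v) [0..<n]"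

text \<open>Every vertex contributes its class, so classes are repeated;
  \<open>output_partition\<close> forms a set and removes the repetitions.\<close>

definition class_list :: "nat \<Rightarrow> state \<Rightarrow> nat list list" where
  "class_list n s = map (class_of n (labels n (map (edge_at (fst s))
     (filter (\<lambda>i. i \<notin> set (snd s)) [0..<length (fst s)])))) [0..<n]"

definition answer_of :: "nat \<Rightarrow> state \<Rightarrow> answer" where
  "answer_of n s = (if connected_list n (fst s)
     then Detachment (map (\<lambda>p. ((fst p, False), (snd p, True))) (fst s))
     else Partition (class_list n s))"

section \<open>Running times of the components of the program\<close>

lemma length_merge_labels [simp]: "length (merge_labels l p) = length l"
  by (simp add: merge_labels_def)

lemma length_labels [simp]: "length (labels N ps) = N"
  unfolding labels_def by (induction ps rule: rev_induct) simp_all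

text \<open>Bounds the size of the label list. It has to hold for arbitrary \<open>ps\<close>, since
  \<open>pbounded\<close> also ranges over invalid inputs; positions out of range read the label
  0.\<close>

lemma labels_le: "x \<in> set (labels N ps) \<Longrightarrow> x \<le> N"
proof (induction ps arbitrary: x rule: rev_induct)
  case Nil
  then show ?case by (simp add: labels_def)
next
  case (snoc p ps)
  have "labels N (ps @ [p]) = merge_labels (labels N ps) p" by (simp add: labels_def)
  then obtain y where y: "y \<in> set (labels N ps)"
    "x = (if y = nth_default 0 (labels N ps) (fst p) then nth_default 0 (labels N ps) (snd p) else y)"
    using snoc.prems by (auto simp: merge_labels_def)
  have "nth_default 0 (labels N ps) (snd p) \<in> insert 0 (set (labels N ps))"
    by (simp add: nth_default_def)
  then show ?case using y snoc.IH by (auto split: if_splits)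
qed

abbreviation "enc_nats \<equiv> enc_list enc_nat"
abbreviation "enc_edge \<equiv> enc_pair enc_nat enc_nat"
abbreviation "enc_edges \<equiv> enc_list enc_edge"

text \<open>Inside a map, filter or loop the program receives the input paired with further data;
  this rule reads a parameter from the first component.\<close>

lemmas ptime_lift = ptime_comp[OF ptime_fst[OF ptime_id]]

lemma ptime_merge_labels:
  assumes l: "ptime A enc_nats l" and p: "ptime A enc_edge p"
  shows "ptime A enc_nats (\<lambda>a. merge_labels (l a) (p a))"
  unfolding merge_labels_def
  by (rule ptime_map[OF l] ptime_If ptime_eq_nat ptime_nth_default ptime_lift[OF l] ptime_lift[OF p]
      ptime_fst[OF ptime_lift[OF p]] ptime_snd[OF ptime_lift[OF p]] ptime_snd ptime_id)+

lemma ptime_labels: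
  assumes N: "ptime A enc_nat N" and ps: "ptime A enc_edges ps"
  shows "ptime A enc_nats (\<lambda>a. labels (N a) (ps a))"
  unfolding labels_def
proof (rule ptime_foldl[OF ps ptime_upt[OF N]])
  show "ptime (enc_pair A (enc_pair enc_edge enc_nats)) enc_nats
      (\<lambda>z. merge_labels (snd (snd z)) (fst (snd z)))"
    by (rule ptime_merge_labels ptime_fst ptime_snd ptime_id)+
  show "pbounded A (\<lambda>a. N a * (N a + 1))"
    using ptime_size[OF N] by (intro pbounded_mult pbounded_add pbounded_const) simp_all
  show "size (enc_nats (foldl merge_labels [0..<N a] (take k (ps a)))) \<le> N a * (N a + 1)" for a k
    using size_enc_list_le[of "labels (N a) (take k (ps a))" enc_nat "N a"] labels_le
    by (simp add: labels_def[symmetric])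
qed

lemma ptime_cover_labels:
  assumes n: "ptime A enc_nat n" and H: "ptime A enc_edges H" and S: "ptime A enc_nats S"
  shows "ptime A enc_nats (\<lambda>a. cover_labels (n a) (H a) (S a))"
  unfolding cover_labels_def
  by (rule ptime_labels ptime_plus n ptime_map ptime_filter ptime_upt ptime_length H ptime_Not
      ptime_mem ptime_lift[OF n] ptime_lift[OF H] ptime_lift[OF S] ptime_Pair ptime_nth_default
      ptime_fst[OF ptime_nth_default] ptime_snd[OF ptime_nth_default] ptime_snd ptime_id)+

lemma ptime_joined:
  assumes "ptime A enc_nat n" "ptime A enc_nats l" "ptime A enc_edge p"
  shows "ptime A enc_bool (\<lambda>a. joined (n a) (l a) (p a))"
  unfolding joined_def
  by (rule ptime_eq_nat ptime_nth_default assms ptime_fst[OF assms(3)] ptime_snd[OF assms(3)] ptime_plus)+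

lemma ptime_crossing_list:
  assumes n: "ptime A enc_nat n" and H: "ptime A enc_edges H" and S: "ptime A enc_nats S"
  shows "ptime A enc_nats (\<lambda>a. crossing_list (n a) (H a) (S a))"
  unfolding crossing_list_def
  by (rule ptime_filter ptime_upt ptime_length H ptime_disj ptime_Not ptime_joined ptime_cover_labels
      ptime_lift[OF n] ptime_lift[OF H] ptime_lift[OF S] ptime_Pair ptime_nth_default
      ptime_fst[OF ptime_nth_default] ptime_snd[OF ptime_nth_default] ptime_snd ptime_id)+

lemma ptime_nonbridge_list:
  assumes n: "ptime A enc_nat n" and H: "ptime A enc_edges H" and S: "ptime A enc_nats S"
  shows "ptime A enc_nats (\<lambda>a. nonbridge_list (n a) (H a) (S a))"
  unfolding nonbridge_list_def
  by (rule ptime_filter ptime_crossing_list n H S ptime_joined ptime_cover_labels ptime_Cons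
      ptime_lift[OF n] ptime_lift[OF H] ptime_lift[OF S] ptime_nth_default ptime_snd ptime_const ptime_id)+

lemma ptime_flip_at:
  assumes H: "ptime A enc_edges H" and i: "ptime A enc_nat i"
  shows "ptime A enc_edges (\<lambda>a. flip_at (H a) (i a))"
  unfolding flip_at_def
  by (rule ptime_map ptime_upt ptime_length H ptime_If ptime_eq_nat ptime_Pair
      ptime_lift[OF H] ptime_lift[OF i] ptime_nth_default
      ptime_fst[OF ptime_nth_default] ptime_snd[OF ptime_nth_default] ptime_snd ptime_id)+

lemma ptime_step:
  assumes n: "ptime A enc_nat n" and s: "ptime A (enc_pair enc_edges enc_nats) s"
  shows "ptime A (enc_pair enc_edges enc_nats) (\<lambda>a. step (n a) (s a))"
  unfolding step_def
  by (rule ptime_If ptime_is_Nil[where X = enc_nat] ptime_nonbridge_list n ptime_fst[OF s] ptime_snd[OF s] ptime_Pair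
      ptime_crossing_list ptime_flip_at ptime_hd_default[where X = enc_nat] ptime_const)+

text \<open>What the size bound on intermediate states requires. It is established without
  \<open>valid_input\<close>, and it limits the length of the second list besides its entries
  because a list may contain repetitions.\<close>

definition state_inv :: "(nat \<times> nat) list \<Rightarrow> state \<Rightarrow> bool" where
  "state_inv es s \<longleftrightarrow> length (fst s) = length es \<and>
     (\<forall>i<length es. edge_at (fst s) i = edge_at es i \<or> edge_at (fst s) i = prod.swap (edge_at es i)) \<and>
     length (snd s) \<le> length es \<and> set (snd s) \<subseteq> {..<length es}"

lemma set_crossing_list: "set (crossing_list n H S) \<subseteq> {..<length H}"
  unfolding crossing_list_def by auto

lemma edge_at_flip_at: "edge_at (flip_at H i) j =
    (if j = i \<and> j < length H then prod.swap (edge_at H j) else edge_at H j)"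
  by (auto simp: flip_at_def nth_default_def prod.swap_def)

lemma state_inv_step:
  assumes "state_inv es s"
  shows "state_inv es (step n s)"
proof (cases "nonbridge_list n (fst s) (snd s) = []")
  case True
  have "length (crossing_list n (fst s) (snd s)) \<le> length (fst s)"
    unfolding crossing_list_def using length_filter_le[of _ "[0..<length (fst s)]"] by simp
  then show ?thesis
    using assms set_crossing_list[of n "fst s" "snd s"] unfolding step_def state_inv_def by (simp add: True)
next
  case False
  have "length (flip_at H i) = length H" for H i by (simp add: flip_at_def)
  then show ?thesis
    using assms False unfolding step_def state_inv_def edge_at_flip_at
    by (auto simp: edge_at_flip_at)
qed

lemma state_inv_funpow: "state_inv es ((step n ^^ k) (es, []))"
  by (induction k) (simp_all add: state_inv_step, simp add: state_inv_def)

text \<open>Exchanging the ends of an edge does not change the size of its encoding, so the edges of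
  the input bound those of every state.\<close>

lemma size_state:
  assumes "state_inv es s"
  shows "size (enc_pair enc_edges enc_nats s) \<le>
    length es * Suc (size (enc_edges es)) + length es * Suc (length es) + 1"
proof -
  have len: "length (fst s) = length es" using assms unfolding state_inv_def by blast
  have "size (enc_edges (fst s)) \<le> length (fst s) * Suc (size (enc_edges es))"
  proof (rule size_enc_list_le)
    fix p assume "p \<in> set (fst s)"
    then obtain i where i: "i < length es" "p = edge_at (fst s) i"
      using assms unfolding state_inv_def by (metis in_set_conv_nth nth_default_nth)
    have "edge_at es i \<in> set es" using i by (simp add: nth_default_nth)
    moreover have "p = edge_at es i \<or> p = prod.swap (edge_at es i)"
      using assms i unfolding state_inv_def by blast
    then have "size (enc_edge p) = size (enc_edge (edge_at es i))"
      by (auto simp: size_enc_pair)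
    ultimately show "size (enc_edge p) \<le> size (enc_edges es)"
      using size_mem_enc_list by metis
  qed
  moreover have "size (enc_nats (snd s)) \<le> length (snd s) * Suc (length es)"
    by (rule size_enc_list_le) (use assms in \<open>auto simp: state_inv_def\<close>)
  moreover have "length (snd s) * Suc (length es) \<le> length es * Suc (length es)"
    using assms unfolding state_inv_def by (intro mult_right_mono) auto
  ultimately show ?thesis
    unfolding size_enc_pair len by linarith
qed

lemma ptime_search:
  assumes n: "ptime A enc_nat n" and es: "ptime A enc_edges es"
  shows "ptime A (enc_pair enc_edges enc_nats) (\<lambda>a. search (n a) (es a))"
  unfolding search_def
proof (rule ptime_funpow)
  show "ptime A enc_nat (\<lambda>a. iterations (n a) (length (es a)))"
    unfolding iterations_def by (rule ptime_plus ptime_mult n ptime_length es ptime_const)+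
  show "ptime A (enc_pair enc_edges enc_nats) (\<lambda>a. (es a, []))"
    by (rule ptime_Pair es ptime_const)+
  show "ptime (enc_pair A (enc_pair enc_edges enc_nats)) (enc_pair enc_edges enc_nats)
      (\<lambda>z. step (n (fst z)) (snd z))"
    by (rule ptime_step ptime_lift[OF n] ptime_snd ptime_id)+
  have "pbounded A (\<lambda>a. length (es a))"
    using ptime_size[OF ptime_length[OF es]] by simp
  then show "pbounded A (\<lambda>a. length (es a) * (size (enc_edges (es a)) + 1) + length (es a) * (length (es a) + 1) + 1)"
    by (intro pbounded_add pbounded_mult pbounded_const ptime_size[OF es])
  show "size (enc_pair enc_edges enc_nats ((step (n a) ^^ k) (es a, []))) \<le>
      length (es a) * (size (enc_edges (es a)) + 1) + length (es a) * (length (es a) + 1) + 1" for a k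
    using size_state[OF state_inv_funpow] unfolding Suc_eq_plus1 .
qed

lemma ptime_connected_list:
  assumes n: "ptime A enc_nat n" and H: "ptime A enc_edges H"
  shows "ptime A enc_bool (\<lambda>a. connected_list (n a) (H a))"
  unfolding connected_list_def
  by (rule ptime_is_Nil[where X = enc_nat] ptime_filter ptime_upt ptime_plus n ptime_Not ptime_eq_nat ptime_nth_default
      ptime_cover_labels ptime_lift[OF n] ptime_lift[OF H] ptime_const ptime_snd ptime_id)+

lemma ptime_class_of:
  assumes n: "ptime A enc_nat n" and l: "ptime A enc_nats l" and u: "ptime A enc_nat u"
  shows "ptime A enc_nats (\<lambda>a. class_of (n a) (l a) (u a))"
  unfolding class_of_def
  by (rule ptime_filter ptime_upt n ptime_eq_nat ptime_nth_default ptime_lift[OF l] ptime_lift[OF u]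
      ptime_snd ptime_id)+

lemma ptime_class_list:
  assumes n: "ptime A enc_nat n" and s: "ptime A (enc_pair enc_edges enc_nats) s"
  shows "ptime A (enc_list enc_nats) (\<lambda>a. class_list (n a) (s a))"
proof -
  note H = ptime_fst[OF s] and S = ptime_snd[OF s]
  have l: "ptime A enc_nats (\<lambda>a. labels (n a) (map (edge_at (fst (s a)))
     (filter (\<lambda>i. i \<notin> set (snd (s a))) [0..<length (fst (s a))])))"
    by (rule ptime_labels n ptime_map ptime_filter ptime_upt ptime_length H ptime_Not
      ptime_mem ptime_lift[OF H] ptime_lift[OF S] ptime_nth_default ptime_snd ptime_id)+
  show ?thesis
    unfolding class_list_def
    by (rule ptime_map ptime_upt n ptime_class_of ptime_lift[OF n] ptime_lift[OF l] ptime_snd ptime_id)+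
qed

lemma ptime_Detachment:
  assumes "ptime A (enc_list (enc_pair (enc_pair enc_nat enc_bool) (enc_pair enc_nat enc_bool))) h"
  shows "ptime A enc_output (\<lambda>a. Detachment (h a))"
proof -
  let ?B = "enc_pair enc_bool (enc_list (enc_pair (enc_pair enc_nat enc_bool) (enc_pair enc_nat enc_bool)))"
  have "enc_output (Detachment hs) = ?B (True, hs)" for hs by (simp add: enc_pair_def)
  with ptime_Pair[OF ptime_const assms, of enc_bool True] show ?thesis
    by (simp add: ptime_def realizes_def)
qed

lemma ptime_Partition:
  assumes "ptime A (enc_list enc_nats) h"
  shows "ptime A enc_output (\<lambda>a. Partition (h a))"
proof -
  have "enc_output (Partition xss) = enc_pair enc_bool (enc_list enc_nats) (False, xss)" for xss
    by (simp add: enc_pair_def)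
  with ptime_Pair[OF ptime_const assms, of enc_bool False] show ?thesis
    by (simp add: ptime_def realizes_def)
qed

lemma ptime_answer_of:
  assumes n: "ptime A enc_nat n" and s: "ptime A (enc_pair enc_edges enc_nats) s"
  shows "ptime A enc_output (\<lambda>a. answer_of (n a) (s a))"
  unfolding answer_of_def
  by (rule ptime_If ptime_connected_list n ptime_fst[OF s] ptime_Detachment ptime_Partition ptime_class_list s
      ptime_map ptime_Pair ptime_const ptime_fst[OF ptime_snd[OF ptime_id]] ptime_snd[OF ptime_snd[OF ptime_id]])+

section \<open>Correctness of the program\<close>

lemma eqcl_map_prod:
  assumes "(x, y) \<in> eqcl A"
  shows "(f x, f y) \<in> eqcl (map_prod f f ` A)"
  using assms
proof (induction rule: eqcl_induct)
  case (step y z)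
  then have "(f y, f z) \<in> eqcl (map_prod f f ` A)" by (intro eqcl_base) force
  with step.IH show ?case by (rule eqcl_trans)
next
  case (step_sym y z)
  then have "(f z, f y) \<in> eqcl (map_prod f f ` A)" by (intro eqcl_base) force
  then show ?case by (rule eqcl_trans[OF step_sym.IH eqcl_sym])
qed simp

text \<open>Induction on the merges: relabelling identifies the classes of \<open>a\<close> and
  \<open>b\<close>, and the resulting equality of labels splits into the three cases of
  \<open>eqcl_insertD\<close>.\<close>

lemma labels_eq_iff:
  assumes "set ps \<subseteq> {..<N} \<times> {..<N}" "i < N" "j < N"
  shows "nth_default 0 (labels N ps) i = nth_default 0 (labels N ps) j \<longleftrightarrow> (i, j) \<in> eqcl (set ps)"
  using assms
proof (induction ps arbitrary: i j rule: rev_induct)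
  case Nil
  have "(i, j) \<in> eqcl {} \<longleftrightarrow> i = j" by (simp add: eqcl_def)
  then show ?case using Nil by (simp add: labels_def nth_default_def)
next
  case (snoc p ps)
  obtain a b where p: "p = (a, b)" by (rule prod.exhaust)
  let ?l = "nth_default 0 (labels N ps)" and ?l' = "nth_default 0 (labels N (ps @ [p]))"
  have ab: "a < N" "b < N" and ps: "set ps \<subseteq> {..<N} \<times> {..<N}" using snoc.prems p by auto
  note IH = snoc.IH[OF ps]
  have "labels N (ps @ [p]) = merge_labels (labels N ps) p" by (simp add: labels_def)
  then have l': "?l' k = (if ?l k = ?l a then ?l b else ?l k)" if "k < N" for k
    using that p by (simp add: merge_labels_def nth_default_def)
  have set: "set (ps @ [p]) = insert (a, b) (set ps)" using p by simp
  have "?l' i = ?l' j \<longleftrightarrow> ?l i = ?l j \<or> ?l i = ?l a \<and> ?l b = ?l j \<or> ?l i = ?l b \<and> ?l a = ?l j"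
    unfolding l'[OF snoc.prems(2)] l'[OF snoc.prems(3)] by auto
  also have "\<dots> \<longleftrightarrow> (i, j) \<in> eqcl (set ps) \<or> (i, a) \<in> eqcl (set ps) \<and> (b, j) \<in> eqcl (set ps) \<or>
      (i, b) \<in> eqcl (set ps) \<and> (a, j) \<in> eqcl (set ps)"
    using IH ab snoc.prems(2,3) by simp
  also have "\<dots> \<longleftrightarrow> (i, j) \<in> eqcl (insert (a, b) (set ps))"
  proof
    let ?B = "insert (a, b) (set ps)"
    have m: "eqcl (set ps) \<subseteq> eqcl ?B" by (rule eqcl_mono) blast
    have e: "(a, b) \<in> eqcl ?B" "(b, a) \<in> eqcl ?B"
      by (rule eqcl_base, simp, rule eqcl_sym, rule eqcl_base, simp)
    assume "(i, j) \<in> eqcl (set ps) \<or> (i, a) \<in> eqcl (set ps) \<and> (b, j) \<in> eqcl (set ps) \<or>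
      (i, b) \<in> eqcl (set ps) \<and> (a, j) \<in> eqcl (set ps)"
    then consider "(i, j) \<in> eqcl ?B" | "(i, a) \<in> eqcl ?B" "(b, j) \<in> eqcl ?B"
      | "(i, b) \<in> eqcl ?B" "(a, j) \<in> eqcl ?B" using m by blast
    then show "(i, j) \<in> eqcl ?B"
      by cases (assumption, (meson e eqcl_trans)+)
  qed (rule eqcl_insertD)
  finally show ?case unfolding set .
qed

definition node :: "nat \<Rightarrow> nat \<times> bool \<Rightarrow> nat" where
  "node n x = (if snd x then n + fst x else fst x)"

definition unnode :: "nat \<Rightarrow> nat \<Rightarrow> nat \<times> bool" where
  "unnode n k = (if k < n then (k, False) else (k - n, True))"

lemma unnode_node: "fst x < n \<Longrightarrow> unnode n (node n x) = x"
  by (cases x) (auto simp: unnode_def node_def)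

text \<open>Walks are transported along the numbering \<open>node\<close> and back along its left
  inverse \<open>unnode\<close>.\<close>

lemma cover_labels_eq_iff:
  assumes H: "edge_at H ` {..<length H} \<subseteq> {..<n} \<times> {..<n}" and "fst x < n" "fst y < n"
  shows "nth_default 0 (cover_labels n H S) (node n x) = nth_default 0 (cover_labels n H S) (node n y) \<longleftrightarrow>
    (x, y) \<in> reach {..<length H} (edge_at H) (set S)"
proof -
  let ?A = "(\<lambda>e. arc (edge_at H e)) ` ({..<length H} - set S)"
  let ?ps = "map (\<lambda>i. (fst (edge_at H i), n + snd (edge_at H i))) (filter (\<lambda>i. i \<notin> set S) [0..<length H])"
  have range: "fst (edge_at H i) < n" "snd (edge_at H i) < n" if "i < length H" for i
  proof -
    have "edge_at H i \<in> {..<n} \<times> {..<n}" using H that by blast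
    then show "fst (edge_at H i) < n" "snd (edge_at H i) < n" by (auto simp: mem_Times_iff)
  qed
  have set: "set ?ps = map_prod (node n) (node n) ` ?A"
    by (auto simp: image_image arc_def node_def map_prod_def image_iff)
  have "map_prod (unnode n) (unnode n) ` map_prod (node n) (node n) ` ?A = ?A"
  proof -
    have "map_prod (unnode n) (unnode n) (map_prod (node n) (node n) (arc (edge_at H i))) = arc (edge_at H i)"
      if "i < length H" for i
      using range[OF that] by (simp add: arc_def unnode_node)
    then show ?thesis unfolding image_image by (intro image_cong) simp_all
  qed
  then have "(node n x, node n y) \<in> eqcl (set ?ps) \<longleftrightarrow> (x, y) \<in> eqcl ?A"
    using eqcl_map_prod[of x y ?A "node n"] eqcl_map_prod[of "node n x" "node n y" "set ?ps" "unnode n"]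
      unnode_node[OF assms(2)] unnode_node[OF assms(3)] unfolding set by auto
  moreover have "set ?ps \<subseteq> {..<n + n} \<times> {..<n + n}"
    using range by (auto simp: trans_less_add1)
  moreover have "node n x < n + n" "node n y < n + n"
    using assms(2,3) unfolding node_def by auto
  ultimately show ?thesis
    unfolding cover_labels_def reach_def by (simp add: labels_eq_iff)
qed

lemma joined_iff:
  assumes H: "edge_at H ` {..<length H} \<subseteq> {..<n} \<times> {..<n}" and "p \<in> {..<n} \<times> {..<n}"
  shows "joined n (cover_labels n H S) p \<longleftrightarrow> arc p \<in> reach {..<length H} (edge_at H) (set S)"
  using cover_labels_eq_iff[OF H, of "fst (arc p)" "snd (arc p)" S] assms(2)
  by (simp add: joined_def node_def arc_def mem_Times_iff)

lemma set_crossing_list_eq: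
  assumes H: "edge_at H ` {..<length H} \<subseteq> {..<n} \<times> {..<n}"
  shows "set (crossing_list n H S) = crossing {..<length H} (edge_at H) (set S)"
proof -
  have "\<not> joined n (cover_labels n H S) (edge_at H i) \<or>
      \<not> joined n (cover_labels n H S) (snd (edge_at H i), fst (edge_at H i)) \<longleftrightarrow>
      arc (edge_at H i) \<notin> reach {..<length H} (edge_at H) (set S) \<or>
      arc (prod.swap (edge_at H i)) \<notin> reach {..<length H} (edge_at H) (set S)"
    if i: "i < length H" for i
  proof -
    have "edge_at H i \<in> {..<n} \<times> {..<n}" using H i by blast
    then have "(snd (edge_at H i), fst (edge_at H i)) \<in> {..<n} \<times> {..<n}" by (simp add: mem_Times_iff)
    then show ?thesis using \<open>edge_at H i \<in> _\<close> joined_iff[OF H] by (simp add: prod.swap_def)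
  qed
  then show ?thesis unfolding crossing_list_def crossing_def by auto
qed

lemma set_nonbridge_list_eq:
  assumes H: "edge_at H ` {..<length H} \<subseteq> {..<n} \<times> {..<n}"
  shows "set (nonbridge_list n H S) =
    {e \<in> crossing {..<length H} (edge_at H) (set S). nonbridge {..<length H} (edge_at H) e}"
proof -
  have "joined n (cover_labels n H [i]) (edge_at H i) \<longleftrightarrow> nonbridge {..<length H} (edge_at H) i"
    if "i \<in> set (crossing_list n H S)" for i
  proof -
    have "i < length H" using that set_crossing_list[of n H S] by blast
    then have "edge_at H i \<in> {..<n} \<times> {..<n}" using H by blast
    then show ?thesis using joined_iff[OF H, of "edge_at H i" "[i]"] by (simp add: nonbridge_def)
  qed
  then show ?thesis unfolding nonbridge_list_def set_filter set_crossing_list_eq[OF H, symmetric] by blast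
qed

text \<open>The program is one deterministic refinement of the abstract search: it reverses the
  first candidate.\<close>

lemma search_step_step:
  assumes H: "edge_at (fst s) ` {..<length (fst s)} \<subseteq> {..<n} \<times> {..<n}"
  shows "search_step {..<length (fst s)} (edge_at (fst s)) (set (snd s))
    (edge_at (fst (step n s))) (set (snd (step n s)))"
proof (cases "nonbridge_list n (fst s) (snd s)")
  case Nil
  then have "set (nonbridge_list n (fst s) (snd s)) = {}" by simp
  then have "\<forall>e\<in>crossing {..<length (fst s)} (edge_at (fst s)) (set (snd s)).
      \<not> nonbridge {..<length (fst s)} (edge_at (fst s)) e"
    unfolding set_nonbridge_list_eq[OF H] by blast
  moreover have "step n s = (fst s, crossing_list n (fst s) (snd s))" using Nil by (simp add: step_def)
  ultimately show ?thesis
    unfolding search_step_def by (simp add: set_crossing_list_eq[OF H])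
next
  case (Cons e es)
  then have "e \<in> set (nonbridge_list n (fst s) (snd s))" by simp
  then have e: "e \<in> crossing {..<length (fst s)} (edge_at (fst s)) (set (snd s))"
    "nonbridge {..<length (fst s)} (edge_at (fst s)) e"
    unfolding set_nonbridge_list_eq[OF H] by simp_all
  have s: "step n s = (flip_at (fst s) e, [])" using Cons by (simp add: step_def hd_default_def)
  have "e < length (fst s)" using e(1) by (simp add: crossing_def)
  \<comment> \<open>Beyond the list both sides have the default value \<open>(0, 0)\<close>, so they
    agree as functions on all indices.\<close>
  then have "edge_at (flip_at (fst s) e) = flip (edge_at (fst s)) e"
    unfolding flip_def by (intro ext) (auto simp: edge_at_flip_at)
  then show ?thesis unfolding search_step_def s using e by auto
qed

text \<open>The measure drops until \<open>F\<close> holds and \<open>F\<close> then persists, so a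
  fixed number of iterations replaces a termination test.\<close>

lemma funpow_reaches:
  fixes \<mu> :: "'s \<Rightarrow> nat"
  assumes "\<And>s. I s \<Longrightarrow> I (f s)" "\<And>s. I s \<Longrightarrow> F s \<or> \<mu> (f s) < \<mu> s" "\<And>s. I s \<Longrightarrow> F s \<Longrightarrow> F (f s)"
    and "I s" "\<mu> s \<le> N"
  shows "F ((f ^^ N) s)"
proof -
  have pers: "F ((f ^^ k) s)" if "I s" "F s" for k s
  proof -
    have "I ((f ^^ k) s) \<and> F ((f ^^ k) s)" by (induction k) (use that assms(1,3) in auto)
    then show ?thesis by blast
  qed
  show ?thesis
    using assms(4,5)
  proof (induction N arbitrary: s)
    case 0
    then show ?case using assms(2)[of s] by auto
  next
    case (Suc N)
    show ?case
    proof (cases "F s")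
      case True
      then show ?thesis using pers[OF Suc.prems(1)] by blast
    next
      case False
      then have "\<mu> (f s) \<le> N" using assms(2)[OF Suc.prems(1)] Suc.prems(2) by auto
      from Suc.IH[OF assms(1)[OF Suc.prems(1)] this] show ?thesis by (simp add: funpow_swap1)
    qed
  qed
qed

section \<open>The search on the input graph\<close>

lemma multigraph_input_graph:
  assumes "valid_input n es"
  shows "multigraph (input_graph n es)"
proof -
  have e: "fst (es ! i) < n" "snd (es ! i) < n" "fst (es ! i) \<noteq> snd (es ! i)" if "i < length es" for i
    using bspec[OF assms[unfolded valid_input_def] nth_mem[OF that]] by (simp_all add: case_prod_unfold)
  show ?thesis
    unfolding multigraph_def
  proof (intro conjI ballI)
    fix i assume "i \<in> edges (input_graph n es)"
    then have "i < length es" by (simp add: input_graph_def)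
    note i = e[OF this]
    show "ends (input_graph n es) i \<subseteq> verts (input_graph n es)"
      using i(1,2) by (simp add: input_graph_def list_ends_def)
    show "card (ends (input_graph n es) i) = 2"
      using i(3) by (simp add: input_graph_def list_ends_def)
  qed (simp_all add: input_graph_def)
qed

definition good_state :: "nat \<Rightarrow> (nat \<times> nat) list \<Rightarrow> state \<Rightarrow> bool" where
  "good_state n es s \<longleftrightarrow> length (fst s) = length es \<and> orients (edge_at (fst s)) (input_graph n es) \<and>
     search_inv {..<length es} (edge_at (fst s)) (set (snd s))"

text \<open>Stated for the set of marked edges, since \<open>step\<close> may replace the list by
  another one with the same elements.\<close>

definition final_state :: "(nat \<times> nat) list \<Rightarrow> state \<Rightarrow> bool" where
  "final_state es s \<longleftrightarrow> crossing {..<length es} (edge_at (fst s)) (set (snd s)) = set (snd s) \<and>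
     (\<forall>e\<in>set (snd s). \<not> nonbridge {..<length es} (edge_at (fst s)) e)"

lemma good_state_range:
  assumes "valid_input n es" "good_state n es s"
  shows "edge_at (fst s) ` {..<length es} \<subseteq> {..<n} \<times> {..<n}"
  using orients_verts[OF multigraph_input_graph[OF assms(1)], of "edge_at (fst s)"] assms(2)
  by (simp add: good_state_def input_graph_def)

lemma length_fst_step [simp]: "length (fst (step n s)) = length (fst s)"
  by (simp add: step_def flip_at_def)

lemma good_state_search_step:
  assumes "valid_input n es" "good_state n es s"
  shows "search_step {..<length es} (edge_at (fst s)) (set (snd s))
    (edge_at (fst (step n s))) (set (snd (step n s)))"
  using search_step_step[of s n] good_state_range[OF assms] assms(2) by (simp add: good_state_def)

lemma good_state_step:
  assumes "valid_input n es" "good_state n es s"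
  shows "good_state n es (step n s)"
  using search_step_orients[OF _ good_state_search_step[OF assms]]
    search_step_inv[OF _ good_state_search_step[OF assms]] assms(2)
  unfolding good_state_def by simp

lemma final_state_step:
  assumes "valid_input n es" "good_state n es s" "final_state es s"
  shows "edge_at (fst (step n s)) = edge_at (fst s)" "set (snd (step n s)) = set (snd s)"
  using good_state_search_step[OF assms(1,2)] assms(3)
  unfolding search_step_def final_state_def by auto

lemma good_state_potential:
  assumes v: "valid_input n es" and g: "good_state n es s"
  shows "final_state es s \<or>
    potential {..<n} {..<length es} (edge_at (fst (step n s))) (set (snd (step n s))) <
    potential {..<n} {..<length es} (edge_at (fst s)) (set (snd s))"
proof (rule disjCI)
  let ?d = "edge_at (fst s)" and ?S = "set (snd s)"
  let ?d' = "edge_at (fst (step n s))" and ?S' = "set (snd (step n s))"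
  assume n: "\<not> potential {..<n} {..<length es} ?d' ?S' < potential {..<n} {..<length es} ?d ?S"
  note step = good_state_search_step[OF v g]
  have "?d' = ?d \<and> ?S' = ?S"
  proof (rule ccontr)
    assume "\<not> (?d' = ?d \<and> ?S' = ?S)"
    then show False
      using search_step_potential[OF _ _ good_state_range[OF v g] _ step] g n
      by (auto simp: good_state_def)
  qed
  then have step: "search_step {..<length es} ?d ?S ?d ?S" using step by simp
  \<comment> \<open>An edge of the input has distinct ends, so reversing it changes
    \<open>?d\<close>; the step that changed nothing was therefore a growing step.\<close>
  have "flip ?d e \<noteq> ?d" if "e \<in> crossing {..<length es} ?d ?S" for e
  proof
    assume "flip ?d e = ?d"
    then have "prod.swap (?d e) = ?d e" unfolding flip_def by (metis fun_upd_same)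
    then have "fst (?d e) = snd (?d e)" by (metis fst_swap)
    moreover have e: "e \<in> edges (input_graph n es)" using that by (simp add: crossing_def input_graph_def)
    then have "card (ends (input_graph n es) e) = 2"
      using multigraph_input_graph[OF v] unfolding multigraph_def by blast
    moreover have "orients ?d (input_graph n es)" using g by (simp add: good_state_def)
    ultimately show False using orients_ends[of ?d _ e] e by simp
  qed
  then show "final_state es s" using step unfolding search_step_def final_state_def by (metis (no_types))
qed

lemma good_state_init: "good_state n es (es, [])"
proof -
  have "orients (edge_at es) (input_graph n es)"
    unfolding orients_def by (simp add: input_graph_def list_ends_def nth_default_def)
  moreover have "search_inv {..<length es} (edge_at es) {}"
    unfolding search_inv_def by (auto intro: exI[of _ 0])
  ultimately show ?thesis by (simp add: good_state_def)
qed

lemma potential_le_iterations: "potential {..<n} {..<m} d S \<le> iterations n m"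
proof -
  have "comps ({..<n} \<times> UNIV) (reach {..<m} d {}) \<le> card ({..<n} \<times> (UNIV :: bool set))"
    unfolding comps_def by (intro card_image_le) simp
  then have "comps ({..<n} \<times> UNIV) (reach {..<m} d {}) \<le> n + n"
    by (simp add: card_cartesian_product)
  then have "comps ({..<n} \<times> UNIV) (reach {..<m} d {}) * (m + 2) + card (bridge_levels {..<m} d) \<le>
      (n + n) * (m + 2) + (m + 1)"
    using card_bridge_levels[of "{..<m}" d] by (intro add_mono mult_right_mono) simp_all
  then have "(comps ({..<n} \<times> UNIV) (reach {..<m} d {}) * (m + 2) + card (bridge_levels {..<m} d)) * (m + 1) \<le>
      ((n + n) * (m + 2) + (m + 1)) * (m + 1)" by (rule mult_right_mono) simp
  then show ?thesis unfolding potential_def iterations_def card_lessThan by linarith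
qed

lemma search_correct:
  assumes v: "valid_input n es"
  shows "good_state n es (search n es)" "final_state es (search n es)"
proof -
  have "good_state n es ((step n ^^ k) (es, []))" for k
    by (induction k) (simp_all add: good_state_init good_state_step[OF v])
  then show "good_state n es (search n es)" unfolding search_def .
  let ?\<mu> = "\<lambda>s. potential {..<n} {..<length es} (edge_at (fst s)) (set (snd s))"
  show "final_state es (search n es)"
    unfolding search_def
  proof (rule funpow_reaches[where I = "good_state n es" and \<mu> = ?\<mu>])
    show "final_state es (step n s)" if "good_state n es s" "final_state es s" for s
      using that(2) final_state_step[OF v that] by (simp add: final_state_def)
  qed (use good_state_step[OF v] good_state_potential[OF v] good_state_init potential_le_iterations in auto)
qed

section \<open>Correctness of the answer\<close>

lemma connected_list_iff:
  assumes H: "edge_at H ` {..<length H} \<subseteq> {..<n} \<times> {..<n}"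
  shows "connected_list n H \<longleftrightarrow>
    ({..<n} \<times> UNIV) \<times> ({..<n} \<times> UNIV) \<subseteq> reach {..<length H} (edge_at H) {}"
proof -
  let ?l = "nth_default 0 (cover_labels n H [])" and ?W = "{..<n} \<times> (UNIV :: bool set)"
  have nodes: "node n ` ?W = {..<n + n}"
  proof (intro equalityI subsetI)
    fix k assume "k \<in> {..<n + n}"
    then show "k \<in> node n ` ?W"
      by (intro image_eqI[of _ _ "unnode n k"]) (auto simp: node_def unnode_def)
  qed (auto simp: node_def)
  have "connected_list n H \<longleftrightarrow> (\<forall>i\<in>{..<n + n}. ?l i = ?l 0)"
    unfolding connected_list_def filter_empty_conv set_upt atLeast0LessThan by (simp only: not_not)
  also have "\<dots> \<longleftrightarrow> (\<forall>i\<in>{..<n + n}. \<forall>j\<in>{..<n + n}. ?l i = ?l j)"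
  proof
    assume all: "\<forall>i\<in>{..<n + n}. ?l i = ?l 0"
    show "\<forall>i\<in>{..<n + n}. \<forall>j\<in>{..<n + n}. ?l i = ?l j"
      by (intro ballI, rule trans[OF bspec[OF all] bspec[OF all, symmetric]])
  next
    assume all: "\<forall>i\<in>{..<n + n}. \<forall>j\<in>{..<n + n}. ?l i = ?l j"
    show "\<forall>i\<in>{..<n + n}. ?l i = ?l 0"
    proof
      fix i assume "i \<in> {..<n + n}"
      moreover from this have "0 \<in> {..<n + n}" by auto
      ultimately show "?l i = ?l 0" using all by blast
    qed
  qed
  also have "\<dots> \<longleftrightarrow> (\<forall>x\<in>?W. \<forall>y\<in>?W. ?l (node n x) = ?l (node n y))"
    unfolding nodes[symmetric] by (simp only: ball_simps(9))
  also have "\<dots> \<longleftrightarrow> (\<forall>x\<in>?W. \<forall>y\<in>?W. (x, y) \<in> reach {..<length H} (edge_at H) {})"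
    using cover_labels_eq_iff[OF H, of _ _ "[]"] by (intro ball_cong refl) (simp add: mem_Times_iff)
  finally show ?thesis by auto
qed

lemma output_partition_class_list:
  assumes H: "edge_at (fst s) ` {..<length (fst s)} \<subseteq> {..<n} \<times> {..<n}"
  shows "output_partition (class_list n s) =
    classes {..<n} (eqcl (edge_at (fst s) ` ({..<length (fst s)} - set (snd s))))"
proof -
  let ?ps = "map (edge_at (fst s)) (filter (\<lambda>i. i \<notin> set (snd s)) [0..<length (fst s)])"
  have ps: "set ?ps = edge_at (fst s) ` ({..<length (fst s)} - set (snd s))" by auto
  have "set ?ps \<subseteq> {..<n} \<times> {..<n}" unfolding ps using H by blast
  from labels_eq_iff[OF this]
  have "set (class_of n (labels n ?ps) u) = {v \<in> {..<n}. (u, v) \<in> eqcl (set ?ps)}" if "u < n" for u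
    using that unfolding class_of_def by auto
  then show ?thesis
    unfolding output_partition_def class_list_def classes_def ps[symmetric] set_map image_image
    by (intro image_cong) auto
qed

lemma answer_of_correct:
  assumes v: "valid_input n es"
  shows "correct_output n es (answer_of n (search n es))"
proof -
  define s where "s = search n es"
  let ?G = "input_graph n es" and ?d = "edge_at (fst s)"
  note G = multigraph_input_graph[OF v]
  have g: "good_state n es s" and f: "final_state es s" unfolding s_def by (rule search_correct[OF v])+
  have len: "length (fst s) = length es" and d: "orients ?d ?G" using g by (auto simp: good_state_def)
  have VE: "verts ?G = {..<n}" "edges ?G = {..<length es}" by (simp_all add: input_graph_def)
  note range = good_state_range[OF v g]
  show ?thesis
  proof (cases "connected_list n (fst s)")
    case True
    let ?hs = "map (\<lambda>p. ((fst p, False), (snd p, True))) (fst s)"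
    have "good_two_detachment ?G (output_graph n ?hs)"
    proof (rule good_two_detachmentI[OF d])
      show "?d ` edges ?G \<subseteq> verts ?G \<times> verts ?G" unfolding VE by (rule range)
      show "(verts ?G \<times> UNIV) \<times> (verts ?G \<times> UNIV) \<subseteq> reach (edges ?G) ?d {}"
        unfolding VE using connected_list_iff[of "fst s" n] range True len by simp
    qed (simp_all add: VE output_graph_def len list_ends_def arc_def nth_default_nth)
    then show ?thesis using True unfolding s_def[symmetric] correct_output_def answer_of_def by auto
  next
    case False
    let ?Q = "output_partition (class_list n s)"
    have Q: "?Q = classes (verts ?G) (eqcl (?d ` (edges ?G - set (snd s))))"
      unfolding VE using output_partition_class_list[of s n] range len by simp
    have "\<not> partition_condition ?G ?Q"
      unfolding Q
    proof (rule search_fixpoint_violates[OF G d])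
      show "set (snd s) \<subseteq> edges ?G"
        using f unfolding VE final_state_def crossing_def by blast
      show "crossing (edges ?G) ?d (set (snd s)) \<subseteq> set (snd s)"
        "\<forall>e\<in>set (snd s). \<not> nonbridge (edges ?G) ?d e"
        using f unfolding VE final_state_def by auto
      show "\<not> (verts ?G \<times> UNIV) \<times> (verts ?G \<times> UNIV) \<subseteq> reach (edges ?G) ?d {}"
        unfolding VE using connected_list_iff[of "fst s" n] range False len by simp
    qed
    moreover have "partition_on (verts ?G) ?Q" unfolding Q by (rule partition_on_classes)
    \<comment> \<open>The violated inequality excludes a good detachment by necessity, so
      \<open>correct_output\<close> asks for a partition.\<close>
    moreover from calculation have "\<nexists>H. good_two_detachment ?G H"
      using good_two_detachment_necessary[OF G] by blast
    ultimately show ?thesis using False unfolding s_def[symmetric] correct_output_def answer_of_def by auto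
  qed
qed

section \<open>The time bound in terms of vertices and edges\<close>

lemma size_enc_input:
  assumes "valid_input n es"
  shows "size (enc_input n es) \<le> 1 + n + length es * (2 * n + 2)"
proof -
  have "size (enc_edge p) \<le> 2 * n + 1" if "p \<in> set es" for p
    using assms that unfolding valid_input_def by (auto simp: size_enc_pair)
  from size_enc_list_le[of es enc_edge, OF this] show ?thesis
    by (simp add: enc_input_def algebra_simps)
qed

text \<open>The composed program is polynomial in the encoding size. Only for valid inputs is that
  size polynomial in \<open>n + length es\<close>, since vertex numbers are unary and validity keeps
  them below \<open>n\<close>.\<close>

lemma exists_algorithm: "\<exists>c. poly_time_detachment_algorithm c"
proof -
  let ?A = "enc_pair enc_nat enc_edges"
  have "ptime ?A enc_output (\<lambda>z. answer_of (fst z) (search (fst z) (snd z)))"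
    by (rule ptime_answer_of ptime_search ptime_fst ptime_snd ptime_id)+
  then obtain c K T where T: "pbounded ?A T"
    and c: "realizes c K T ?A enc_output (\<lambda>z. answer_of (fst z) (search (fst z) (snd z)))"
    unfolding ptime_def by blast
  obtain k where k: "\<And>z. T z \<le> (size (?A z) + 2) ^ k" using T unfolding pbounded_def by blast
  have "poly_time_detachment_algorithm c"
    unfolding poly_time_detachment_algorithm_def
  \<comment> \<open>With \<open>x = n + length es\<close>, the encoding size plus 2 is at most
    \<open>3 + 3 * x + 2 * x^2\<close>, and \<open>k\<close> is the exponent of the time
    bound.\<close>
  proof (intro exI[of _ "[:3, 3, 2:] ^ k"] allI impI)
    fix n es assume v: "valid_input n es"
    have A: "?A (n, es) = enc_input n es" by (simp add: enc_pair_def enc_input_def)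
    obtain t s' where t: "exec c ((\<lambda>_. Leaf)(0 := enc_input n es)) t s'"
      "s' 0 = enc_output (answer_of n (search n es))" "t \<le> T (n, es)"
      using realizesD[OF c order_refl, of "(\<lambda>_. Leaf)(0 := enc_input n es)" "(n, es)"] A by auto
    have "t \<le> (size (enc_input n es) + 2) ^ k"
      using t(3) k[of "(n, es)"] unfolding A by simp
    also have "\<dots> \<le> poly [:3, 3, 2:] (n + length es) ^ k"
      using size_enc_input[OF v] by (intro power_mono) (auto simp: algebra_simps)
    finally have "t \<le> poly ([:3, 3, 2:] ^ k) (n + length es)" by (simp add: poly_power)
    then show "\<exists>out t. computes c (enc_input n es) t (enc_output out) \<and>
        t \<le> poly ([:3, 3, 2:] ^ k) (n + length es) \<and> correct_output n es out"
      using t(1,2) answer_of_correct[OF v] unfolding computes_def by blast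
  qed
  then show ?thesis by blast
qed

theorem theorem7p2:
  shows "(\<forall>G :: ('a, 'b) mgraph. multigraph G \<longrightarrow>
            ((\<exists>H. good_two_detachment G H) \<longleftrightarrow>
             (\<forall>Q. partition_on (verts G) Q \<longrightarrow> partition_condition G Q))) \<and>
         (\<exists>c. poly_time_detachment_algorithm c)"
  using good_two_detachment_iff exists_algorithm by blast

end
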